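(* Let $n\ge2$, let $D$ be a domain in $\overline{\mathbb R^n}=\mathbb R^n\cup\{\infty\}$, and let $\Phi:[0,\infty]\to[0,\infty]$ be a non-decreasing convex function. Suppose that the classes $S^{\Phi}_{M,\Delta}$ are equicontinuous (normal) for all $M\in(0,\infty)$ and all $\Delta\in(0,1)$. Then $$\int_{\delta_*}^{\infty}\frac{d\tau}{\tau\,[\Phi^{-1}(\tau)]^{\frac1{n-1}}}=\infty$$ for all $\delta_*\in(\tau_0,\infty)$, where $\tau_0:=\Phi(0)$.
   Context: Notation: $dm$ is Lebesgue measure. $\overline{\mathbb R^n}$ carries the spherical (chordal) metric $h(x,y)=\frac{|x-y|}{\sqrt{1+|x|^2}\sqrt{1+|y|^2}}$ for $x,y\neq\infty$, $h(x,\infty)=\frac1{\sqrt{1+|x|^2}}$; for a set $E$, $h(E)=\sup_{x_1,x_2\in E}h(x_1,x_2)$. $\Phi$ is convex on $[0,\infty]$ if $\Phi(\lambda t_1+(1-\lambda)t_2)\le\lambda\Phi(t_1)+(1-\lambda)\Phi(t_2)$ for all $t_1,t_2\in[0,\infty]$, $\lambda\in[0,1]$. For non-decreasing $\Phi$, $\Phi^{-1}(\tau)=\inf\{t\in[0,\infty]:\Phi(t)\ge\tau\}$, with $\inf\emptyset=\infty$; $1/\infty=0$, $1/0=\infty$. Inner dilatation: at a point $x$ of differentiability of $f$, with $J(x,f)=\det f'(x)$ and $l(f'(x))=\inf_{v\ne0}|f'(x)v|/|v|$, set $K_I(x,f)=|J(x,f)|/l(f'(x))^n$ if $J(x,f)\ne0$,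 $K_I(x,f)=1$ if $f'(x)=0$, and $K_I(x,f)=\infty$ at all remaining points. Class $S^{\Phi}_{M,\Delta}$: all homeomorphisms (onto their image) $f:D\to\overline{\mathbb R^n}$ of the Sobolev class $W^{1,n}_{loc}$ with $K_I(\cdot,f)$ locally integrable, such that $h(\overline{\mathbb R^n}\setminus f(D))\ge\Delta$ and $$\int_D\Phi(K_I(x,f))\,\frac{dm(x)}{(1+|x|^2)^n}\le M.$$ (Where $\infty\in D$ or $f$ takes the value $\infty$, the local conditions are understood after composing with the inversion $x\mapsto x/|x|^2$.) A family $\mathfrak F$ of mappings $D\to\overline{\mathbb R^n}$ is equicontinuous if at every $x_0\in D$: for every $\varepsilon>0$ there is a neighbourhood $U$ of $x_0$ in $D$ with $h(f(x),f(x_0))<\varepsilon$ for all $x\in U$, $f\in\mathfrak F$. A family of continuous mappings is normal if every sequence in it has a subsequence converging, uniformly (w.r.t. $h$) on each compact subset of $D$, to a continuous mapping $D\to\overline{\mathbb R^n}$; for mappings into the compact space $\overline{\mathbb R^n}$ the two properties are equivalent (Arzelà–Ascoli).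
   Formalization: The domain D is assumed not to be all of the extended space; for D equal to the whole space every class is empty, hence vacuously equicontinuous, and the claim fails, e.g. for Φ(t)=t. *)

theory Defs
  imports "HOL-Analysis.Analysis"
begin

section \<open>The extended space with its chordal metric\<close>

text \<open>The one-point compactification of \<open>real^'n\<close> is the type \<open>(real^'n) option\<close>, where
  \<^term>\<open>None\<close> is the point at infinity.\<close>

fun chordal :: "(real^'n) option \<Rightarrow> (real^'n) option \<Rightarrow> real" where
  "chordal (Some x) (Some y) = norm (x - y) / (sqrt (1 + (norm x)\<^sup>2) * sqrt (1 + (norm y)\<^sup>2))"
| "chordal (Some x) None = 1 / sqrt (1 + (norm x)\<^sup>2)"
| "chordal None (Some y) = 1 / sqrt (1 + (norm y)\<^sup>2)"
| "chordal None None = 0"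

text \<open>The chordal distance is the Euclidean distance of the stereographic images on a sphere of
  diameter 1.\<close>

fun stereo :: "(real^'n) option \<Rightarrow> (real^'n) \<times> real" where
  "stereo (Some x) = (inverse (1 + (norm x)\<^sup>2) *\<^sub>R x, 1 - inverse (1 + (norm x)\<^sup>2))"
| "stereo None = (0, 1)"

lemma chordal_eq_dist_stereo:
  fixes p q :: "(real^'n) option"
  shows "chordal p q = dist (stereo p) (stereo q)"
proof -
  have pos: "1 + (norm z)\<^sup>2 > 0" for z :: "real^'n"
    by (simp add: add_pos_nonneg)
  have SS: "chordal (Some x) (Some y) = dist (stereo (Some x)) (stereo (Some y))" for x y :: "real^'n"
  proof -
    define a where "a = 1 + (norm x)\<^sup>2"
    define b where "b = 1 + (norm y)\<^sup>2"
    have ab: "a > 0" "b > 0" using pos by (auto simp: a_def b_def)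
    have nx: "x \<bullet> x = a - 1" and ny: "y \<bullet> y = b - 1"
      by (auto simp: a_def b_def power2_norm_eq_inner)
    have "(dist (inverse a *\<^sub>R x) (inverse b *\<^sub>R y))\<^sup>2
        = (inverse a)\<^sup>2 * (a - 1) + (inverse b)\<^sup>2 * (b - 1) - 2 * inverse a * inverse b * (x \<bullet> y)"
      unfolding dist_norm power2_norm_eq_inner
      by (simp add: inner_diff_left inner_diff_right nx ny inner_commute[of y x])
         (simp add: power2_eq_square algebra_simps)
    moreover have "(dist (1 - inverse a) (1 - inverse b))\<^sup>2 = (inverse a - inverse b)\<^sup>2"
      by (simp add: dist_real_def power2_commute)
    moreover have "(norm (x - y))\<^sup>2 = a + b - 2 - 2 * (x \<bullet> y)"
      by (simp add: power2_norm_eq_inner inner_diff_left inner_diff_right nx ny inner_commute)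
    moreover have "(inverse a)\<^sup>2 * (a - 1) + (inverse b)\<^sup>2 * (b - 1) - 2 * inverse a * inverse b * (x \<bullet> y)
        + (inverse a - inverse b)\<^sup>2 = (a + b - 2 - 2 * (x \<bullet> y)) / (a * b)"
      using ab by (simp add: field_simps power2_eq_square)
    ultimately have "(dist (inverse a *\<^sub>R x) (inverse b *\<^sub>R y))\<^sup>2 + (dist (1 - inverse a) (1 - inverse b))\<^sup>2
        = (norm (x - y))\<^sup>2 / (a * b)"
      by simp
    then show ?thesis
      by (simp add: dist_Pair_Pair flip: a_def b_def)
         (simp add: real_sqrt_divide real_sqrt_mult)
  qed
  have SN: "chordal (Some x) None = dist (stereo (Some x)) (stereo None)" for x :: "real^'n"
  proof -
    define a where "a = 1 + (norm x)\<^sup>2"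
    have a: "a > 0" using pos by (auto simp: a_def)
    have nx: "(norm x)\<^sup>2 = a - 1" by (simp add: a_def)
    have "(dist (inverse a *\<^sub>R x) 0)\<^sup>2 + (dist (1 - inverse a) 1)\<^sup>2 = 1 / a"
    proof -
      have "(dist (inverse a *\<^sub>R x) 0)\<^sup>2 = (inverse a)\<^sup>2 * (a - 1)"
        using a by (simp add: power_mult_distrib nx)
      moreover have "(dist (1 - inverse a) 1)\<^sup>2 = (inverse a)\<^sup>2"
        using a by (simp add: dist_real_def)
      moreover have "(inverse a)\<^sup>2 * (a - 1) + (inverse a)\<^sup>2 = 1 / a"
        using a by (simp add: field_simps power2_eq_square)
      ultimately show ?thesis by simp
    qed
    then show ?thesis
      by (simp add: dist_Pair_Pair flip: a_def) (simp add: real_sqrt_divide)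
  qed
  show ?thesis
  proof (cases p; cases q)
    fix y assume "p = None" "q = Some y"
    then show ?thesis using SN[of y] by (simp add: dist_commute)
  qed (use SS SN in auto)
qed

lemma inj_stereo:
  fixes p q :: "(real^'n) option"
  shows "stereo p = stereo q \<Longrightarrow> p = q"
proof -
  have pos: "1 + (norm z)\<^sup>2 \<noteq> 0" for z :: "real^'n"
    by (metis add_pos_nonneg less_irrefl zero_le_power2 zero_less_one)
  show "stereo p = stereo q \<Longrightarrow> p = q"
    by (cases p; cases q) (use pos in auto)
qed

interpretation chordal: Metric_space UNIV chordal
proof
  fix x y z :: "(real^'n) option"
  show "(chordal x y = 0) = (x = y)"
    using inj_stereo by (auto simp: chordal_eq_dist_stereo)
  show "chordal x z \<le> chordal x y + chordal y z"
    unfolding chordal_eq_dist_stereo by (rule dist_triangle)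
qed (simp_all add: chordal_eq_dist_stereo dist_commute)

abbreviation xtop :: "(real^'n) option topology" where
  "xtop \<equiv> Metric_space.mtopology UNIV chordal"

definition chordal_diam :: "(real^'n) option set \<Rightarrow> ennreal" where
  "chordal_diam E = (SUP x\<in>E. SUP y\<in>E. ennreal (chordal x y))"

definition xdomain :: "(real^'n) option set \<Rightarrow> bool" where
  "xdomain D \<longleftrightarrow> D \<noteq> {} \<and> openin xtop D \<and> connectedin xtop D"


section \<open>Local coordinates\<close>

fun inversion :: "(real^'n) option \<Rightarrow> (real^'n) option" where
  "inversion (Some x) = (if x = 0 then None else Some ((1 / (norm x)\<^sup>2) *\<^sub>R x))"
| "inversion None = Some 0"

text \<open>Near a finite point \<open>p\<close> the coordinate is the identity, near infinity it is the inversion.\<close>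

definition xchart :: "(real^'n) option \<Rightarrow> real^'n \<Rightarrow> (real^'n) option" where
  "xchart p x = (if p = None then inversion (Some x) else Some x)"

definition xcoord :: "(real^'n) option \<Rightarrow> (real^'n) option \<Rightarrow> real^'n" where
  "xcoord p q = (if p = None then the (inversion q) else the q)"

definition local_rep ::
  "((real^'n) option \<Rightarrow> (real^'n) option) \<Rightarrow> (real^'n) option \<Rightarrow> real^'n \<Rightarrow> real^'n" where
  "local_rep f p x = xcoord (f p) (f (xchart p x))"

text \<open>\<open>U\<close> is a neighbourhood of \<open>p\<close> in its coordinate, inside \<open>D\<close>, on which \<open>local_rep f p\<close>
  represents \<open>f\<close>.\<close>

definition coord_nbhd ::
  "(real^'n) option set \<Rightarrow> ((real^'n) option \<Rightarrow> (real^'n) option) \<Rightarrow> (real^'n) option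
    \<Rightarrow> (real^'n) set \<Rightarrow> bool" where
  "coord_nbhd D f p U \<longleftrightarrow> open U \<and> xcoord p p \<in> U \<and>
     (\<forall>x\<in>U. xchart p x \<in> D \<and> f (xchart p x) \<in> range (xchart (f p)))"


section \<open>Sobolev functions\<close>

primrec Ck :: "nat \<Rightarrow> (real^'n \<Rightarrow> real) \<Rightarrow> bool" where
  "Ck 0 \<phi> \<longleftrightarrow> continuous_on UNIV \<phi>"
| "Ck (Suc k) \<phi> \<longleftrightarrow> (\<forall>x. \<phi> differentiable at x) \<and>
     (\<forall>b\<in>Basis. Ck k (\<lambda>x. frechet_derivative \<phi> (at x) b))"

definition test_fun :: "(real^'n) set \<Rightarrow> (real^'n \<Rightarrow> real) \<Rightarrow> bool" where
  "test_fun U \<phi> \<longleftrightarrow> (\<forall>k. Ck k \<phi>) \<and> compact (closure {x. \<phi> x \<noteq> 0}) \<and> closure {x. \<phi> x \<noteq> 0} \<subseteq> U"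

definition in_Lp :: "nat \<Rightarrow> (real^'n) set \<Rightarrow> (real^'n \<Rightarrow> real^'n) \<Rightarrow> bool" where
  "in_Lp p U g \<longleftrightarrow> set_borel_measurable lebesgue U g \<and>
     (\<integral>\<^sup>+x\<in>U. ennreal (norm (g x) ^ p) \<partial>lebesgue) < \<infinity>"

definition weak_partial ::
  "(real^'n) set \<Rightarrow> real^'n \<Rightarrow> (real^'n \<Rightarrow> real^'n) \<Rightarrow> (real^'n \<Rightarrow> real^'n) \<Rightarrow> bool" where
  "weak_partial U b g G \<longleftrightarrow> (\<forall>\<phi>. test_fun U \<phi> \<longrightarrow>
     (LINT x:U|lebesgue. frechet_derivative \<phi> (at x) b *\<^sub>R g x) = - (LINT x:U|lebesgue. \<phi> x *\<^sub>R G x))"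

definition sobolev_W1 :: "nat \<Rightarrow> (real^'n) set \<Rightarrow> (real^'n \<Rightarrow> real^'n) \<Rightarrow> bool" where
  "sobolev_W1 p U g \<longleftrightarrow> in_Lp p U g \<and>
     (\<forall>b\<in>Basis. \<exists>G. in_Lp p U G \<and> weak_partial U b g G)"

definition W1n_loc ::
  "(real^'n) option set \<Rightarrow> ((real^'n) option \<Rightarrow> (real^'n) option) \<Rightarrow> bool" where
  "W1n_loc D f \<longleftrightarrow>
     (\<forall>p\<in>D. \<exists>U. coord_nbhd D f p U \<and> sobolev_W1 CARD('n) U (local_rep f p))"


section \<open>Inner dilatation\<close>

definition min_stretch :: "(real^'n \<Rightarrow> real^'n) \<Rightarrow> real" where
  "min_stretch A = (INF v\<in>{v. v \<noteq> 0}. norm (A v) / norm v)"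

definition K_I :: "(real^'n \<Rightarrow> real^'n) \<Rightarrow> real^'n \<Rightarrow> ennreal" where
  "K_I g x =
     (if g differentiable at x then
        let A = frechet_derivative g (at x); J = det (matrix A) in
          if J \<noteq> 0 then ennreal (\<bar>J\<bar> / min_stretch A ^ CARD('n))
          else if A = (\<lambda>v. 0) then 1
          else \<infinity>
      else \<infinity>)"

definition xK_I ::
  "((real^'n) option \<Rightarrow> (real^'n) option) \<Rightarrow> (real^'n) option \<Rightarrow> ennreal" where
  "xK_I f p = K_I (local_rep f p) (xcoord p p)"

definition K_I_loc_integrable ::
  "(real^'n) option set \<Rightarrow> ((real^'n) option \<Rightarrow> (real^'n) option) \<Rightarrow> bool" where
  "K_I_loc_integrable D f \<longleftrightarrow>
     (\<forall>p\<in>D. \<exists>U. coord_nbhd D f p U \<and>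
        (\<lambda>x. K_I (local_rep f p) x * indicator U x) \<in> borel_measurable lebesgue \<and>
        (\<integral>\<^sup>+x\<in>U. K_I (local_rep f p) x \<partial>lebesgue) < \<infinity>)"


section \<open>The function classes\<close>

definition S_class ::
  "(real^'n) option set \<Rightarrow> (ennreal \<Rightarrow> ennreal) \<Rightarrow> real \<Rightarrow> real
    \<Rightarrow> ((real^'n) option \<Rightarrow> (real^'n) option) set" where
  "S_class D \<Phi> M \<Delta> = {f.
     embedding_map (subtopology xtop D) xtop f \<and>
     W1n_loc D f \<and> K_I_loc_integrable D f \<and>
     ennreal \<Delta> \<le> chordal_diam (UNIV - f ` D) \<and>
     (\<integral>\<^sup>+x\<in>{x. Some x \<in> D}. \<Phi> (xK_I f (Some x)) * ennreal (1 / (1 + (norm x)\<^sup>2) ^ CARD('n)) \<partial>lebesgue)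
       \<le> ennreal M}"

definition equicontinuous_fam ::
  "(real^'n) option set \<Rightarrow> ((real^'n) option \<Rightarrow> (real^'n) option) set \<Rightarrow> bool" where
  "equicontinuous_fam D F \<longleftrightarrow>
     (\<forall>x0\<in>D. \<forall>\<epsilon>>0. \<exists>U. openin (subtopology xtop D) U \<and> x0 \<in> U \<and>
        (\<forall>x\<in>U. \<forall>f\<in>F. chordal (f x) (f x0) < \<epsilon>))"

definition normal_fam ::
  "(real^'n) option set \<Rightarrow> ((real^'n) option \<Rightarrow> (real^'n) option) set \<Rightarrow> bool" where
  "normal_fam D F \<longleftrightarrow>
     (\<forall>s :: nat \<Rightarrow> (real^'n) option \<Rightarrow> (real^'n) option. range s \<subseteq> F \<longrightarrow>
        (\<exists>(r :: nat \<Rightarrow> nat) g. strict_mono r \<and> continuous_map (subtopology xtop D) xtop g \<and>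
           (\<forall>C. C \<subseteq> D \<and> compactin xtop C \<longrightarrow>
              (\<forall>\<epsilon>>0. \<exists>N. \<forall>k\<ge>N. \<forall>x\<in>C. chordal (s (r k) x) (g x) < \<epsilon>))))"


section \<open>Functions on the extended half-line\<close>

text \<open>In \<^typ>\<open>ennreal\<close> the conventions \<open>0 * \<infinity> = 0\<close>, \<open>1 / 0 = \<infinity>\<close>, \<open>1 / \<infinity> = 0\<close> and
  \<open>Inf {} = \<infinity>\<close> hold.\<close>

definition ext_convex :: "(ennreal \<Rightarrow> ennreal) \<Rightarrow> bool" where
  "ext_convex \<Phi> \<longleftrightarrow> (\<forall>t1 t2. \<forall>l\<in>{0..1::real}.
     \<Phi> (ennreal l * t1 + ennreal (1 - l) * t2) \<le> ennreal l * \<Phi> t1 + ennreal (1 - l) * \<Phi> t2)"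

definition gen_inv :: "(ennreal \<Rightarrow> ennreal) \<Rightarrow> ennreal \<Rightarrow> ennreal" where
  "gen_inv \<Phi> \<tau> = Inf {t. \<Phi> t \<ge> \<tau>}"

text \<open>Power with a positive real exponent.\<close>

definition ennpowr :: "ennreal \<Rightarrow> real \<Rightarrow> ennreal" where
  "ennpowr x a = (if x = \<infinity> then \<infinity> else ennreal (enn2real x powr a))"

end

theory Submission
  imports Defs
begin

text \<open>
  Suppose the integral is finite. Then there is an increasing profile \<open>P : \<real> \<rightarrow> \<real>\<close>, bounded below and equal
  to the identity on \<open>[0,\<infinity>)\<close>, such that \<open>\<Phi>(P'(s)\<^bsup>1-n\<^esup>)\<close> grows at most like \<open>e\<^bsup>-s\<^esup>\<close> as \<open>s\<close> tends to \<open>-\<infinity>\<close>: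
  \<open>P'(s)\<^bsup>1-n\<^esup>\<close> is essentially \<open>\<Phi>\<^sup>-\<^sup>1(e\<^bsup>-s\<^esup>)\<close>. The radial map \<open>log |f(x)| = P(log |x|)\<close> has inner dilatation
  \<open>P'(log |x|)\<^bsup>1-n\<^esup>\<close>, so its \<open>\<Phi>\<close>-energy density is controlled by \<open>1/|x|\<close>, which is integrable in dimension
  \<open>n \<ge> 2\<close>; yet \<open>|f(x)|\<close> stays away from 0 as \<open>x\<close> tends to 0, i.e. the map opens a cavity.

  Such a cavity is opened once at a point missing from \<open>D\<close>, which bounds the omitted set from below even
  if \<open>D\<close> has a single boundary point. Around a point \<open>x0\<close> of \<open>D\<close> the same map is used, made conformal in a
  ball of radius comparable to \<open>e\<^bsup>-m\<^esup>\<close>. The resulting homeomorphisms lie in one class \<open>S_class D \<Phi> M \<Delta>\<close> and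
  move points tending to \<open>x0\<close> to a fixed distance from the image of \<open>x0\<close>.
\<close>

section \<open>Integration of radial functions\<close>

lemma emeasure_radial_density_atMost:
  assumes "0 < n" "0 \<le> V"
  shows "emeasure (density lborel (\<lambda>r. ennreal (real n * V * r ^ (n - 1)) * indicator {0..} r)) {..r}
    = ennreal (V * r ^ n) * indicator {0..} r" (is "emeasure ?N _ = _")
proof (cases "0 \<le> r")
  case True
  have "emeasure ?N {..r} = (\<integral>\<^sup>+s. ennreal (real n * V * s ^ (n - 1)) * indicator {0..r} s \<partial>lborel)"
    by (subst emeasure_density) (auto intro!: nn_integral_cong simp: indicator_def)
  also have "\<dots> = ennreal (V * r ^ n - V * 0 ^ n)"
    using True assms(2) by (intro nn_integral_FTC_Icc) (auto intro!: derivative_eq_intros)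
  finally show ?thesis using True assms(1) by (simp add: zero_power)
next
  case False
  then show ?thesis
    by (subst emeasure_density) (auto simp: nn_integral_0_iff_AE split: split_indicator)
qed

lemma distr_norm_lborel:
  "distr (lborel :: 'a::euclidean_space measure) borel norm =
    density lborel
      (\<lambda>r. ennreal (real DIM('a) * unit_ball_vol DIM('a) * r ^ (DIM('a) - 1)) * indicator {0..} r)"
    (is "?M = ?N")
proof -
  have distr_atMost: "emeasure ?M {..r} = ennreal (unit_ball_vol DIM('a) * r ^ DIM('a)) * indicator {0..} r"
    for r
  proof -
    have "emeasure ?M {..r} = emeasure lborel (cball (0::'a) r)"
      by (subst emeasure_distr) (auto intro!: arg_cong[where f = "emeasure _"])
    then show ?thesis by (cases "0 \<le> r") (auto simp: emeasure_cball)
  qed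
  show "?M = ?N"
  proof (rule measure_eqI_generator_eq[where E = "range atMost" and \<Omega> = UNIV and A = "\<lambda>i. {..real i}"])
    show "emeasure ?M X = emeasure ?N X" if "X \<in> range atMost" for X
      using that distr_atMost emeasure_radial_density_atMost[of "DIM('a)" "unit_ball_vol DIM('a)"] by auto
    show "Int_stable (range (atMost :: real \<Rightarrow> _))"
      by (auto simp: Int_stable_def)
    show "(\<Union>i. {..real i}) = UNIV"
      using real_arch_simple by auto
    show "emeasure ?M {..real i} \<noteq> \<infinity>" for i
      by (simp add: distr_atMost indicator_def)
    have borel: "sets (borel :: real measure) = sigma_sets UNIV (range atMost)"
      by (subst borel_eq_atMost) simp
    then show "sets ?M = sigma_sets UNIV (range atMost)" "sets ?N = sigma_sets UNIV (range atMost)"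
      by simp_all
  qed auto
qed

lemma nn_integral_radial:
  assumes [measurable]: "f \<in> borel_measurable borel"
  shows "(\<integral>\<^sup>+(x::'a::euclidean_space). f (norm (x - c)) \<partial>lborel) =
    (\<integral>\<^sup>+r\<in>{0..}. ennreal (real DIM('a) * unit_ball_vol DIM('a) * r ^ (DIM('a) - 1)) * f r \<partial>lborel)"
proof -
  have "(\<integral>\<^sup>+(x::'a). f (norm (x - c)) \<partial>lborel) = (\<integral>\<^sup>+x. f (norm (x - c)) \<partial>distr lborel borel ((+) c))"
    by (simp add: lborel_distr_plus)
  also have "\<dots> = (\<integral>\<^sup>+(x::'a). f (norm x) \<partial>lborel)"
    by (subst nn_integral_distr) auto
  also have "\<dots> = (\<integral>\<^sup>+r. f r \<partial>distr (lborel :: 'a measure) borel norm)"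
    by (subst nn_integral_distr) auto
  also have "\<dots> =
      (\<integral>\<^sup>+r\<in>{0..}. ennreal (real DIM('a) * unit_ball_vol DIM('a) * r ^ (DIM('a) - 1)) * f r \<partial>lborel)"
    unfolding distr_norm_lborel by (subst nn_integral_density) (auto simp: mult_ac)
  finally show ?thesis .
qed

lemma nn_integral_inverse_norm_finite:
  fixes c :: "'a::euclidean_space"
  assumes "2 \<le> DIM('a)"
  shows "(\<integral>\<^sup>+x. ennreal (1 / (norm (x - c) * (1 + (norm (x - c))\<^sup>2) ^ (DIM('a) - 1))) \<partial>lborel) < \<infinity>"
proof -
  define k where "k = DIM('a) - 2"
  define V where "V = real DIM('a) * unit_ball_vol DIM('a)"
  have k: "DIM('a) - 1 = Suc k" using assms by (simp add: k_def)
  have V: "0 \<le> V" by (simp add: V_def)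
  have radial: "V * r ^ Suc k * (1 / (r * (1 + r\<^sup>2) ^ Suc k)) \<le> V * (1 / (1 + r\<^sup>2))"
    if "0 \<le> r" for r :: real
  proof -
    define q where "q = 1 + r\<^sup>2"
    have q: "0 < q" by (simp add: q_def add_pos_nonneg)
    have "0 \<le> (r - 1)\<^sup>2" by simp
    then have "r \<le> q" using that by (simp add: q_def power2_diff)
    then have "(r / q) ^ k \<le> 1" using that q by (intro power_le_one) auto
    moreover have "r ^ Suc k * (1 / (r * q ^ Suc k)) = (if r = 0 then 0 else (r / q) ^ k / q)"
      by (simp add: power_divide)
    ultimately have "r ^ Suc k * (1 / (r * q ^ Suc k)) \<le> 1 / q"
      using q by (simp add: divide_right_mono)
    then show ?thesis unfolding q_def[symmetric] mult.assoc by (rule mult_left_mono) (rule V)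
  qed
  have "(\<integral>\<^sup>+x. ennreal (1 / (norm (x - c) * (1 + (norm (x - c))\<^sup>2) ^ (DIM('a) - 1))) \<partial>lborel)
      = (\<integral>\<^sup>+r\<in>{0..}. ennreal (V * r ^ Suc k) * ennreal (1 / (r * (1 + r\<^sup>2) ^ Suc k)) \<partial>lborel)"
    unfolding V_def k[symmetric] by (rule nn_integral_radial) simp
  also have "\<dots> \<le> (\<integral>\<^sup>+r\<in>{0..}. ennreal (V * (1 / (1 + r\<^sup>2))) \<partial>lborel)"
    using radial V
    by (intro nn_integral_mono)
      (auto simp: ennreal_mult'[symmetric] simp del: power_Suc split: split_indicator intro!: ennreal_leI)
  also have "\<dots> = ennreal (V * (pi / 2) - V * arctan 0)"
  proof (intro nn_integral_FTC_atLeast)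
    show "((\<lambda>r. V * arctan r) has_real_derivative V * (1 / (1 + r\<^sup>2))) (at r)" for r
      by (auto intro!: derivative_eq_intros simp: divide_inverse)
    show "0 \<le> V * (1 / (1 + r\<^sup>2))" for r
      using V by (simp add: add_nonneg_nonneg)
    show "((\<lambda>r. V * arctan r) \<longlongrightarrow> V * (pi / 2)) at_top"
      by (intro tendsto_mult_left tendsto_arctan_at_top)
  qed simp
  finally show ?thesis by (rule order.strict_trans1) simp
qed

lemma one_plus_norm_square_le:
  fixes x c :: "'a::real_normed_vector"
  shows "1 + (norm (x - c))\<^sup>2 \<le> 2 * (1 + (norm c)\<^sup>2) * (1 + (norm x)\<^sup>2)"
proof -
  have "(norm (x - c))\<^sup>2 \<le> (norm x + norm c)\<^sup>2"
    using norm_triangle_ineq4 by (intro power_mono) auto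
  also have "\<dots> \<le> 2 * (norm x)\<^sup>2 + 2 * (norm c)\<^sup>2"
    using sum_squares_bound[of "norm x" "norm c"] by (simp add: power2_sum)
  finally have "1 + (norm (x - c))\<^sup>2 \<le> 2 + 2 * (norm c)\<^sup>2 + 2 * (norm x)\<^sup>2 + 2 * (norm c * norm x)\<^sup>2"
    using zero_le_power2[of "norm c * norm x"] by linarith
  then show ?thesis by (simp add: power_mult_distrib algebra_simps)
qed

definition pole_weight :: "'a::real_normed_vector \<Rightarrow> 'a \<Rightarrow> real" where
  "pole_weight c x = norm (x - c) + 1 / norm (x - c)"

lemma pole_weight_nonneg: "0 \<le> pole_weight c x"
  by (simp add: pole_weight_def)

lemma borel_measurable_pole_weight [measurable]:
  "pole_weight (c :: 'a::euclidean_space) \<in> borel_measurable borel"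
  unfolding pole_weight_def[abs_def] by measurable

definition pole_moment :: "'a::euclidean_space \<Rightarrow> ennreal" where
  "pole_moment c = (\<integral>\<^sup>+x. ennreal (pole_weight c x * (1 / (1 + (norm x)\<^sup>2) ^ DIM('a))) \<partial>lborel)"

lemma pole_moment_finite:
  fixes c :: "'a::euclidean_space"
  assumes "2 \<le> DIM('a)"
  shows "pole_moment c < \<infinity>"
proof -
  define n where "n = DIM('a)"
  define B where "B = (2 * (1 + (norm c)\<^sup>2)) ^ n"
  have B: "0 \<le> B" unfolding B_def by (intro zero_le_power) (simp add: add_nonneg_nonneg)
  have pointwise: "pole_weight c x * (1 / (1 + (norm x)\<^sup>2) ^ n)
      \<le> B * (1 / (norm (x - c) * (1 + (norm (x - c))\<^sup>2) ^ (n - 1)))" for x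
  proof (cases "x = c")
    case False
    define r where "r = norm (x - c)"
    have r: "0 < r" using False by (simp add: r_def)
    have pos: "0 < 1 + r\<^sup>2" "0 < 1 + (norm x)\<^sup>2" by (simp_all add: add_pos_nonneg)
    have "(1 + r\<^sup>2) ^ n \<le> (2 * (1 + (norm c)\<^sup>2) * (1 + (norm x)\<^sup>2)) ^ n"
      unfolding r_def by (intro power_mono one_plus_norm_square_le) simp
    also have "\<dots> = B * (1 + (norm x)\<^sup>2) ^ n" by (simp add: B_def power_mult_distrib)
    finally have "1 / (1 + (norm x)\<^sup>2) ^ n \<le> B * (1 / (1 + r\<^sup>2) ^ n)"
      using pos by (simp add: divide_simps)
    then have "(r + 1 / r) * (1 / (1 + (norm x)\<^sup>2) ^ n) \<le> (r + 1 / r) * (B * (1 / (1 + r\<^sup>2) ^ n))"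
      using r by (intro mult_left_mono) auto
    also have "(1 + r\<^sup>2) ^ n = (1 + r\<^sup>2) * (1 + r\<^sup>2) ^ (n - 1)"
      using assms by (simp add: n_def flip: power_Suc)
    also have "(r + 1 / r) * (B * (1 / ((1 + r\<^sup>2) * (1 + r\<^sup>2) ^ (n - 1))))
        = B * (1 / (r * (1 + r\<^sup>2) ^ (n - 1)))"
    proof -
      have "r + 1 / r = (1 + r\<^sup>2) / r" using r by (simp add: field_simps power2_eq_square)
      then show ?thesis using pos by simp
    qed
    finally show ?thesis by (simp add: pole_weight_def r_def)
  qed (simp add: pole_weight_def)
  have "(\<integral>\<^sup>+x. ennreal (pole_weight c x * (1 / (1 + (norm x)\<^sup>2) ^ n)) \<partial>lborel)
      \<le> (\<integral>\<^sup>+x. ennreal B * ennreal (1 / (norm (x - c) * (1 + (norm (x - c))\<^sup>2) ^ (n - 1))) \<partial>lborel)"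
    using pointwise B by (intro nn_integral_mono) (simp add: ennreal_leI flip: ennreal_mult')
  also have "\<dots> = ennreal B *
      (\<integral>\<^sup>+x. ennreal (1 / (norm (x - c) * (1 + (norm (x - c))\<^sup>2) ^ (n - 1))) \<partial>lborel)"
    by (rule nn_integral_cmult) simp
  also have "\<dots> < \<infinity>"
    using nn_integral_inverse_norm_finite[OF assms, of c] by (simp add: n_def ennreal_mult_less_top)
  finally show ?thesis by (simp add: pole_moment_def n_def)
qed

section \<open>Densities from the generalized inverse\<close>

lemma gen_inv_mono: "\<tau> \<le> \<tau>' \<Longrightarrow> gen_inv \<Phi> \<tau> \<le> gen_inv \<Phi> \<tau>'"
  unfolding gen_inv_def by (rule Inf_superset_mono) auto

lemma ennpowr_mono: "0 \<le> \<alpha> \<Longrightarrow> x \<le> y \<Longrightarrow> ennpowr x \<alpha> \<le> ennpowr y \<alpha>"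
  by (auto simp: ennpowr_def top_unique less_top intro!: ennreal_leI powr_mono2 enn2real_mono)

lemma ennreal_inverse_antimono:
  fixes a b :: ennreal
  assumes "a \<le> b"
  shows "inverse b \<le> inverse a"
proof (cases a rule: ennreal_cases; cases b rule: ennreal_cases)
  fix x y assume "0 \<le> x" "a = ennreal x" "0 \<le> y" "b = ennreal y"
  with assms show ?thesis
    by (cases "x = 0") (auto simp: inverse_ennreal intro!: ennreal_leI le_imp_inverse_le)
qed (use assms in \<open>auto simp: top_unique\<close>)

definition gen_inv_integrand :: "(ennreal \<Rightarrow> ennreal) \<Rightarrow> real \<Rightarrow> real \<Rightarrow> ennreal" where
  "gen_inv_integrand \<Phi> \<alpha> \<tau> = 1 / (ennreal \<tau> * ennpowr (gen_inv \<Phi> (ennreal \<tau>)) \<alpha>)"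

lemma gen_inv_integrand_antimono: "0 \<le> \<alpha> \<Longrightarrow> antimono (gen_inv_integrand \<Phi> \<alpha>)"
  unfolding gen_inv_integrand_def divide_ennreal_def mult_1
  by (intro antimonoI ennreal_inverse_antimono mult_mono ennpowr_mono gen_inv_mono ennreal_leI) auto

lemma borel_measurable_antimono:
  fixes f :: "real \<Rightarrow> 'b::{linorder_topology, second_countable_topology}"
  assumes "antimono f"
  shows "f \<in> borel_measurable borel"
proof (rule borel_measurableI_greater)
  fix y
  have "is_interval {x. y < f x}"
    unfolding is_interval_1 using antimonoD[OF assms] by (auto intro: order.strict_trans2)
  then show "{x \<in> space borel. y < f x} \<in> sets borel"
    by (simp add: real_interval_borel_measurable)
qed

lemma nn_integral_inverse_greaterThan:
  fixes a :: real
  shows "(\<integral>\<^sup>+\<tau>\<in>{a<..}. ennreal (1 / \<tau>) \<partial>lborel) = \<infinity>"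
proof -
  define T where "T = max 1 (a + 1)"
  have T: "0 < T" "a < T" by (auto simp: T_def)
  have "ennreal t \<le> (\<integral>\<^sup>+\<tau>\<in>{a<..}. ennreal (1 / \<tau>) \<partial>lborel)" if "0 \<le> t" for t
  proof -
    have "ennreal t = ennreal (ln (T * exp t) - ln T)"
      using T by (simp add: ln_mult)
    also have "\<dots> = (\<integral>\<^sup>+\<tau>. ennreal (1 / \<tau>) * indicator {T..T * exp t} \<tau> \<partial>lborel)"
      using T that by (intro nn_integral_FTC_Icc[symmetric])
        (auto intro!: derivative_eq_intros simp: divide_inverse)
    also have "\<dots> \<le> (\<integral>\<^sup>+\<tau>\<in>{a<..}. ennreal (1 / \<tau>) \<partial>lborel)"
      using T by (intro nn_integral_mono) (auto split: split_indicator)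
    finally show ?thesis .
  qed
  then have "of_nat k \<le> (\<integral>\<^sup>+\<tau>\<in>{a<..}. ennreal (1 / \<tau>) \<partial>lborel)" for k :: nat
    by (simp add: ennreal_of_nat_eq_real_of_nat)
  then show ?thesis using ennreal_Ex_less_of_nat by (metis infinity_ennreal_def leD less_top)
qed

lemma gen_inv_integral_finite_imp_finite_at_1:
  assumes "0 \<le> \<alpha>" and fin: "(\<integral>\<^sup>+\<tau>\<in>{\<delta><..}. gen_inv_integrand \<Phi> \<alpha> \<tau> \<partial>lborel) \<noteq> \<infinity>"
  shows "\<Phi> 1 \<noteq> \<infinity>"
proof
  assume "\<Phi> 1 = \<infinity>"
  then have "gen_inv \<Phi> \<tau> \<le> 1" for \<tau>
    unfolding gen_inv_def by (intro Inf_lower) simp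
  then have "ennpowr (gen_inv \<Phi> \<tau>) \<alpha> \<le> ennpowr 1 \<alpha>" for \<tau>
    by (intro ennpowr_mono assms(1))
  then have "ennreal \<tau> * ennpowr (gen_inv \<Phi> (ennreal \<tau>)) \<alpha> \<le> ennreal \<tau> * 1" for \<tau>
    by (intro mult_left_mono) (simp_all add: ennpowr_def)
  then have integrand: "inverse (ennreal \<tau>) \<le> inverse (ennreal \<tau> * ennpowr (gen_inv \<Phi> (ennreal \<tau>)) \<alpha>)" for \<tau>
    using ennreal_inverse_antimono by fastforce
  have "ennreal (1 / \<tau>) \<le> gen_inv_integrand \<Phi> \<alpha> \<tau>" for \<tau>
    using integrand[of \<tau>]
    by (cases "0 < \<tau>")
      (auto simp: gen_inv_integrand_def divide_ennreal_def inverse_ennreal inverse_eq_divide ennreal_neg)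
  then have "(\<integral>\<^sup>+\<tau>\<in>{\<delta><..}. ennreal (1 / \<tau>) \<partial>lborel)
      \<le> (\<integral>\<^sup>+\<tau>\<in>{\<delta><..}. gen_inv_integrand \<Phi> \<alpha> \<tau> \<partial>lborel)"
    by (intro nn_integral_mono mult_right_mono) auto
  then show False
    using fin by (simp add: nn_integral_inverse_greaterThan top_unique)
qed

text \<open>Capping \<open>\<Phi>\<^sup>-\<^sup>1(\<tau>)\<close> by \<open>\<tau>\<close> makes it finite; dividing by \<open>e\<close> keeps it strictly below
  the infimum that defines \<open>gen_inv\<close>.\<close>

definition truncated_inverse :: "(ennreal \<Rightarrow> ennreal) \<Rightarrow> real \<Rightarrow> real" where
  "truncated_inverse \<Phi> \<tau> = max 1 (enn2real (min (gen_inv \<Phi> (ennreal \<tau>)) (ennreal \<tau>)) / exp 1)"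

lemma truncated_inverse_ge_1: "1 \<le> truncated_inverse \<Phi> \<tau>"
  by (simp add: truncated_inverse_def)

lemma truncated_inverse_eq_1:
  assumes "\<tau> \<le> exp 1"
  shows "truncated_inverse \<Phi> \<tau> = 1"
proof -
  have "enn2real (min (gen_inv \<Phi> (ennreal \<tau>)) (ennreal \<tau>)) \<le> enn2real (ennreal (exp 1))"
    using assms by (intro enn2real_mono) (auto simp: min_le_iff_disj ennreal_leI)
  then show ?thesis by (simp add: truncated_inverse_def)
qed

lemma truncated_inverse_mono:
  assumes "\<sigma> \<le> \<tau>"
  shows "truncated_inverse \<Phi> \<sigma> \<le> truncated_inverse \<Phi> \<tau>"
  unfolding truncated_inverse_def
proof (intro max.mono order_refl divide_right_mono enn2real_mono)
  show "min (gen_inv \<Phi> (ennreal \<sigma>)) (ennreal \<sigma>) \<le> min (gen_inv \<Phi> (ennreal \<tau>)) (ennreal \<tau>)"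
    using assms by (intro min.mono gen_inv_mono ennreal_leI)
qed (auto simp: min_less_iff_disj)

lemma Phi_truncated_inverse_le:
  "\<Phi> (ennreal (truncated_inverse \<Phi> \<tau>)) \<le> max (\<Phi> 1) (ennreal \<tau>)"
proof (cases "truncated_inverse \<Phi> \<tau> = 1")
  case False
  define m where "m = min (gen_inv \<Phi> (ennreal \<tau>)) (ennreal \<tau>)"
  have trunc: "truncated_inverse \<Phi> \<tau> = enn2real m / exp 1" "1 < enn2real m / exp 1"
    using False by (auto simp: truncated_inverse_def m_def max_def split: if_splits)
  then have "0 < enn2real m" by (auto simp: field_simps intro: less_trans[OF exp_gt_zero])
  then have "ennreal (enn2real m / exp 1) < ennreal (enn2real m)"
    by (simp add: ennreal_less_iff divide_less_eq)
  also have "\<dots> = m"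
    by (simp add: m_def min_less_iff_disj)
  also have "m \<le> gen_inv \<Phi> (ennreal \<tau>)" by (simp add: m_def)
  finally have "ennreal (truncated_inverse \<Phi> \<tau>) < gen_inv \<Phi> (ennreal \<tau>)"
    by (simp only: trunc(1))
  moreover have "gen_inv \<Phi> (ennreal \<tau>) \<le> ennreal (truncated_inverse \<Phi> \<tau>)"
    if "ennreal \<tau> \<le> \<Phi> (ennreal (truncated_inverse \<Phi> \<tau>))"
    unfolding gen_inv_def using that by (intro Inf_lower) simp
  ultimately have "\<not> ennreal \<tau> \<le> \<Phi> (ennreal (truncated_inverse \<Phi> \<tau>))"
    by (meson leD)
  then show ?thesis by (simp add: max.coboundedI2)
qed simp

lemma truncated_inverse_powr_le:
  assumes "0 < \<alpha>" "0 < \<tau>"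
  shows "ennreal (truncated_inverse \<Phi> \<tau> powr - \<alpha>)
    \<le> ennreal (exp \<alpha>) * (ennreal (\<tau> powr - \<alpha>) + inverse (ennpowr (gen_inv \<Phi> (ennreal \<tau>)) \<alpha>))"
proof -
  define m where "m = min (gen_inv \<Phi> (ennreal \<tau>)) (ennreal \<tau>)"
  have finite_m: "m = ennreal (enn2real m)" by (simp add: m_def min_less_iff_disj)
  have cap: "ennreal (truncated_inverse \<Phi> \<tau> powr - \<alpha>) \<le> ennreal (exp \<alpha>) * inverse (ennpowr m \<alpha>)"
  proof (cases "enn2real m = 0")
    case True
    then have "ennpowr m \<alpha> = 0" using finite_m by (simp add: ennpowr_def)
    then show ?thesis by (simp add: ennreal_mult_top)
  next
    case False
    then have m: "0 < enn2real m" by (simp add: less_le)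
    have "truncated_inverse \<Phi> \<tau> powr - \<alpha> \<le> (enn2real m / exp 1) powr - \<alpha>"
      using m assms(1) by (intro powr_mono2') (auto simp: truncated_inverse_def m_def)
    also have "\<dots> = exp \<alpha> * inverse (enn2real m powr \<alpha>)"
      using m by (simp add: powr_divide powr_minus exp_powr_real field_simps)
    finally have "ennreal (truncated_inverse \<Phi> \<tau> powr - \<alpha>) \<le> ennreal (exp \<alpha> * inverse (enn2real m powr \<alpha>))"
      by (rule ennreal_leI)
    also have "\<dots> = ennreal (exp \<alpha>) * inverse (ennpowr m \<alpha>)"
      using m finite_m by (simp add: ennpowr_def ennreal_mult inverse_ennreal)
    finally show ?thesis .
  qed
  also have "inverse (ennpowr m \<alpha>) \<le> ennreal (\<tau> powr - \<alpha>) + inverse (ennpowr (gen_inv \<Phi> (ennreal \<tau>)) \<alpha>)"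
    using assms(2)
    by (auto simp: m_def min_def ennpowr_def inverse_ennreal powr_minus add_increasing add_increasing2)
  finally show ?thesis by (simp add: mult_left_mono)
qed

definition dilatation_density :: "(ennreal \<Rightarrow> ennreal) \<Rightarrow> real \<Rightarrow> real \<Rightarrow> real" where
  "dilatation_density \<Phi> \<alpha> \<tau> = truncated_inverse \<Phi> \<tau> powr - \<alpha>"

lemma dilatation_density_pos: "0 < dilatation_density \<Phi> \<alpha> \<tau>"
  using truncated_inverse_ge_1[of \<Phi> \<tau>] by (simp add: dilatation_density_def)

lemma dilatation_density_le_1:
  assumes "0 \<le> \<alpha>"
  shows "dilatation_density \<Phi> \<alpha> \<tau> \<le> 1"
  using assms powr_mono2'[of "- \<alpha>" 1 "truncated_inverse \<Phi> \<tau>"] truncated_inverse_ge_1[of \<Phi> \<tau>]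
  by (simp add: dilatation_density_def)

lemma dilatation_density_antimono:
  assumes "0 \<le> \<alpha>"
  shows "antimono (dilatation_density \<Phi> \<alpha>)"
  using assms truncated_inverse_mono truncated_inverse_ge_1 unfolding dilatation_density_def
  by (intro antimonoI powr_mono2') (auto intro: less_le_trans[OF zero_less_one])

lemma dilatation_density_eq_1: "\<tau> \<le> exp 1 \<Longrightarrow> dilatation_density \<Phi> \<alpha> \<tau> = 1"
  by (simp add: dilatation_density_def truncated_inverse_eq_1)

lemma inverse_power_dilatation_density:
  assumes "\<alpha> * real k = 1"
  shows "1 / dilatation_density \<Phi> \<alpha> \<tau> ^ k = truncated_inverse \<Phi> \<tau>"
proof -
  have "dilatation_density \<Phi> \<alpha> \<tau> ^ k = truncated_inverse \<Phi> \<tau> powr - (\<alpha> * real k)"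
    using dilatation_density_pos[of \<Phi> \<alpha> \<tau>]
    by (simp add: dilatation_density_def powr_powr flip: powr_realpow)
  also have "\<dots> = 1 / truncated_inverse \<Phi> \<tau>"
    unfolding assms using truncated_inverse_ge_1[of \<Phi> \<tau>] by (simp add: powr_minus_divide)
  finally show ?thesis by simp
qed

lemma nn_integral_powr_atLeast_finite:
  fixes \<alpha> :: real
  assumes "0 < \<alpha>"
  shows "(\<integral>\<^sup>+\<tau>\<in>{1..}. ennreal (\<tau> powr (- \<alpha> - 1)) \<partial>lborel) < \<infinity>"
proof -
  have "(\<integral>\<^sup>+\<tau>\<in>{1..}. ennreal (\<tau> powr (- \<alpha> - 1)) \<partial>lborel) = ennreal (0 - - (1 powr - \<alpha> / \<alpha>))"
  proof (rule nn_integral_FTC_atLeast)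
    show "((\<lambda>\<tau>. - (\<tau> powr - \<alpha> / \<alpha>)) has_real_derivative \<tau> powr (- \<alpha> - 1)) (at \<tau>)" if "1 \<le> \<tau>" for \<tau>
      using that assms by (auto intro!: derivative_eq_intros)
    have "((\<lambda>\<tau>. \<tau> powr - \<alpha>) \<longlongrightarrow> 0) at_top"
      using assms by (intro tendsto_neg_powr filterlim_ident) auto
    from tendsto_minus[OF tendsto_divide[OF this tendsto_const[of \<alpha>]]]
    show "((\<lambda>\<tau>. - (\<tau> powr - \<alpha> / \<alpha>)) \<longlongrightarrow> 0) at_top"
      using assms by simp
  qed auto
  then show ?thesis by simp
qed

lemma dilatation_density_divide_le:
  assumes "0 < \<alpha>" "0 < \<tau>"
  shows "ennreal (dilatation_density \<Phi> \<alpha> \<tau> / \<tau>)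
    \<le> ennreal (exp \<alpha>) * (ennreal (\<tau> powr (- \<alpha> - 1)) + gen_inv_integrand \<Phi> \<alpha> \<tau>)"
proof -
  let ?J = "inverse (ennpowr (gen_inv \<Phi> (ennreal \<tau>)) \<alpha>)"
  have "ennreal (dilatation_density \<Phi> \<alpha> \<tau> / \<tau>) = ennreal (dilatation_density \<Phi> \<alpha> \<tau>) * ennreal (1 / \<tau>)"
    using assms(2) dilatation_density_pos[of \<Phi> \<alpha> \<tau>] by (simp flip: ennreal_mult')
  also have "\<dots> \<le> ennreal (exp \<alpha>) * (ennreal (\<tau> powr - \<alpha>) + ?J) * ennreal (1 / \<tau>)"
    unfolding dilatation_density_def using assms by (intro mult_right_mono truncated_inverse_powr_le) auto
  also have "\<dots> = ennreal (exp \<alpha>) * (ennreal (\<tau> powr - \<alpha>) * ennreal (1 / \<tau>) + ?J * ennreal (1 / \<tau>))"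
    by (simp only: distrib_left distrib_right mult.assoc)
  also have "ennreal (\<tau> powr - \<alpha>) * ennreal (1 / \<tau>) = ennreal (\<tau> powr (- \<alpha> - 1))"
    using assms(2) by (simp add: powr_diff flip: ennreal_mult'')
  also have "?J * ennreal (1 / \<tau>) = gen_inv_integrand \<Phi> \<alpha> \<tau>"
    using assms(2)
    by (simp add: gen_inv_integrand_def divide_ennreal_def ennreal_inverse_mult' inverse_ennreal
        inverse_eq_divide mult.commute)
  finally show ?thesis .
qed

lemma nn_integral_dilatation_density_finite:
  assumes "0 < \<alpha>" and fin: "(\<integral>\<^sup>+\<tau>\<in>{\<delta><..}. gen_inv_integrand \<Phi> \<alpha> \<tau> \<partial>lborel) \<noteq> \<infinity>"
  shows "(\<integral>\<^sup>+\<tau>\<in>{1..}. ennreal (dilatation_density \<Phi> \<alpha> \<tau> / \<tau>) \<partial>lborel) < \<infinity>"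
proof -
  let ?w = "dilatation_density \<Phi> \<alpha>" and ?J = "gen_inv_integrand \<Phi> \<alpha>"
  have J [measurable]: "?J \<in> borel_measurable borel"
    using assms(1) by (intro borel_measurable_antimono gen_inv_integrand_antimono) simp
  have near: "ennreal (?w \<tau> / \<tau>) \<le> 1" if "1 \<le> \<tau>" for \<tau>
    using that assms(1) dilatation_density_le_1[of \<alpha> \<Phi> \<tau>] by (simp add: divide_le_eq_1)
  have "(\<integral>\<^sup>+\<tau>\<in>{1..}. ennreal (?w \<tau> / \<tau>) \<partial>lborel)
      \<le> (\<integral>\<^sup>+\<tau>. indicator {1..\<delta>} \<tau> + ennreal (exp \<alpha>) *
          (ennreal (\<tau> powr (- \<alpha> - 1)) * indicator {1..} \<tau> + ?J \<tau> * indicator {\<delta><..} \<tau>) \<partial>lborel)"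
  proof (rule nn_integral_mono)
    fix \<tau> :: real
    consider "\<tau> < 1" | "1 \<le> \<tau>" "\<tau> \<le> \<delta>" | "1 \<le> \<tau>" "\<delta> < \<tau>" by linarith
    then show "ennreal (?w \<tau> / \<tau>) * indicator {1..} \<tau> \<le> indicator {1..\<delta>} \<tau> + ennreal (exp \<alpha>) *
        (ennreal (\<tau> powr (- \<alpha> - 1)) * indicator {1..} \<tau> + ?J \<tau> * indicator {\<delta><..} \<tau>)"
      by cases
        (use near[of \<tau>] dilatation_density_divide_le[OF assms(1), of \<tau> \<Phi>] in \<open>auto simp: add_increasing2\<close>)
  qed
  also have "\<dots> = (\<integral>\<^sup>+\<tau>. indicator {1..\<delta>} \<tau> \<partial>lborel) + ennreal (exp \<alpha>) *
      ((\<integral>\<^sup>+\<tau>\<in>{1..}. ennreal (\<tau> powr (- \<alpha> - 1)) \<partial>lborel) + (\<integral>\<^sup>+\<tau>\<in>{\<delta><..}. ?J \<tau> \<partial>lborel))"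
    by (simp add: nn_integral_add nn_integral_cmult)
  also have "\<dots> < \<infinity>"
    using nn_integral_powr_atLeast_finite[OF assms(1)] fin
    by (simp add: ennreal_mult_less_top emeasure_lborel_Icc_eq less_top)
  finally show ?thesis .
qed

section \<open>Radial profiles\<close>

lemma continuous_on_moving_average:
  fixes f :: "real \<Rightarrow> 'a::banach"
  assumes f: "\<And>a b. f integrable_on {a..b}"
  shows "continuous_on UNIV (\<lambda>s. integral {s - 1..s} f)"
proof (intro continuous_at_imp_continuous_on ballI)
  fix x
  define I where "I y = integral {x - 2..y} f" for y
  have I: "continuous_on {x - 2..x + 1} I"
    unfolding I_def using f by (rule indefinite_integral_continuous_1)
  have "continuous_on {x - 1..x + 1} (\<lambda>s. I s - I (s - 1))"
    by (intro continuous_intros continuous_on_compose2[OF I]) auto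
  moreover have "I s - I (s - 1) = integral {s - 1..s} f" if "s \<in> {x - 1..x + 1}" for s
    using that Henstock_Kurzweil_Integration.integral_combine[of "x - 2" "s - 1" s f] f
    by (simp add: I_def algebra_simps)
  ultimately have "continuous_on {x - 1..x + 1} (\<lambda>s. integral {s - 1..s} f)"
    by (rule continuous_on_eq)
  then show "isCont (\<lambda>s. integral {s - 1..s} f) x"
    by (rule continuous_on_interior) simp
qed

lemma moving_average_bounds:
  fixes f :: "real \<Rightarrow> real"
  assumes "mono f"
  shows "f (s - 1) \<le> integral {s - 1..s} f" "integral {s - 1..s} f \<le> f s"
proof -
  have f: "f integrable_on {s - 1..s}"
    using assms by (intro integrable_on_mono_on) (auto simp: mono_on_def mono_def)
  have "integral {s - 1..s} (\<lambda>_. f (s - 1)) \<le> integral {s - 1..s} f"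
    using f monoD[OF assms] by (intro integral_le) auto
  then show "f (s - 1) \<le> integral {s - 1..s} f" by simp
  have "integral {s - 1..s} f \<le> integral {s - 1..s} (\<lambda>_. f s)"
    using f monoD[OF assms] by (intro integral_le) auto
  then show "integral {s - 1..s} f \<le> f s" by simp
qed

text \<open>A profile \<open>P\<close> describes the radial map \<open>log |f(x)| = P(log |x|)\<close>.\<close>

definition radial_profile :: "(real \<Rightarrow> real) \<Rightarrow> (real \<Rightarrow> real) \<Rightarrow> bool" where
  "radial_profile P v \<longleftrightarrow> continuous_on UNIV v \<and>
     (\<forall>s. (P has_real_derivative v s) (at s) \<and> 0 < v s \<and> v s \<le> 1)"

lemma radial_profileD:
  assumes "radial_profile P v"
  shows "continuous_on UNIV v" "(P has_real_derivative v s) (at s)" "0 < v s" "v s \<le> 1"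
  using assms by (auto simp: radial_profile_def)

lemma radial_profile_strict_mono:
  assumes "radial_profile P v"
  shows "strict_mono P"
proof (rule strict_monoI)
  fix a b :: real assume "a < b"
  then show "P a < P b"
    using radial_profileD(2,3)[OF assms] by (blast intro: DERIV_pos_imp_increasing)
qed

lemma radial_profile_ident_plus: "radial_profile (\<lambda>s. s + q) (\<lambda>_. 1)"
  by (auto simp: radial_profile_def intro!: derivative_eq_intros)

lemma radial_profile_signed_shift:
  assumes P: "radial_profile P v" and "\<sigma> * \<sigma> = 1"
  shows "radial_profile (\<lambda>s. a + \<sigma> * P (\<sigma> * (s - a))) (\<lambda>s. v (\<sigma> * (s - a)))"
  unfolding radial_profile_def
proof (intro conjI allI)
  show "continuous_on UNIV (\<lambda>s. v (\<sigma> * (s - a)))"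
    by (rule continuous_on_compose2[OF radial_profileD(1)[OF P]]) (auto intro!: continuous_intros)
  have "((\<lambda>s. \<sigma> * (s - a)) has_real_derivative \<sigma>) (at s)" for s
    by (auto intro!: derivative_eq_intros)
  from DERIV_add[OF DERIV_const DERIV_cmult[OF DERIV_chain2[OF radial_profileD(2)[OF P] this]]]
  have "((\<lambda>s. a + \<sigma> * P (\<sigma> * (s - a))) has_real_derivative \<sigma> * (v (\<sigma> * (s - a)) * \<sigma>)) (at s)" for s
    by simp
  moreover have "\<sigma> * (y * \<sigma>) = y" for y
    using assms(2) by (simp add: mult.left_commute)
  ultimately show "((\<lambda>s. a + \<sigma> * P (\<sigma> * (s - a))) has_real_derivative v (\<sigma> * (s - a))) (at s)" for s
    by simp
qed (use radial_profileD(3,4)[OF P] in auto)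

lemma radial_profile_shift:
  "radial_profile P v \<Longrightarrow> radial_profile (\<lambda>s. a + P (s - a)) (\<lambda>s. v (s - a))"
  using radial_profile_signed_shift[of P v 1 a] by simp

lemma radial_profile_reflect:
  "radial_profile P v \<Longrightarrow> radial_profile (\<lambda>s. a - P (a - s)) (\<lambda>s. v (a - s))"
  using radial_profile_signed_shift[of P v "- 1" a] by simp

lemma exists_radial_profile:
  assumes cont: "continuous_on UNIV v" and bounds: "\<And>s. 0 < v s" "\<And>s. v s \<le> 1"
  obtains P where "radial_profile P v" "P a = b"
proof -
  have "isCont v x" for x
    using cont by (simp add: continuous_on_eq_continuous_at)
  then obtain F where F: "\<And>x. (F has_vector_derivative v x) (at x)"
    using einterval_antiderivative[of "-\<infinity>" "\<infinity>" v] by auto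
  have "((\<lambda>s. F s - F a + b) has_real_derivative v s) (at s)" for s
    using F[of s] by (auto intro!: derivative_eq_intros simp: has_real_derivative_iff_has_vector_derivative)
  then have "radial_profile (\<lambda>s. F s - F a + b) v"
    using cont bounds by (simp add: radial_profile_def)
  then show thesis by (rule that) simp
qed

lemma radial_profile_eqI:
  assumes P: "radial_profile P v" and Q: "radial_profile Q u"
    and S: "convex S" "\<And>s. s \<in> S \<Longrightarrow> v s = u s" "a \<in> S" "P a = Q a" "s \<in> S"
  shows "P s = Q s"
proof -
  have "((\<lambda>s. P s - Q s) has_real_derivative 0) (at s within S)" if "s \<in> S" for s
  proof (rule has_field_derivative_at_within)
    show "((\<lambda>s. P s - Q s) has_real_derivative 0) (at s)"
      using DERIV_diff[OF radial_profileD(2)[OF P] radial_profileD(2)[OF Q], of s] S(2)[OF that]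
      by simp
  qed
  then obtain c where "\<forall>s\<in>S. P s - Q s = c"
    using has_field_derivative_zero_constant[of S "\<lambda>s. P s - Q s"] S(1) by metis
  then have "P s - Q s = P a - Q a" using S(3,5) by metis
  then show ?thesis using S(4) by simp
qed

lemma exists_truncated_profile:
  assumes P: "radial_profile P v"
  obtains Q u q where "radial_profile Q u" "\<And>s. v s \<le> u s"
    "\<And>s. a \<le> s \<Longrightarrow> Q s = P s" "\<And>s. s \<le> a - 1 \<Longrightarrow> Q s = s + q"
proof -
  define u where "u s = max (v s) (min 1 (a - s))" for s
  have "continuous_on UNIV u" unfolding u_def
    by (intro continuous_intros radial_profileD(1)[OF P])
  moreover have "0 < u s" "u s \<le> 1" for s
    using radial_profileD(3,4)[OF P, of s] by (auto simp: u_def)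
  ultimately obtain Q where Q: "radial_profile Q u" "Q a = P a"
    by (rule exists_radial_profile)
  have right: "u s = v s" if "a \<le> s" for s
    using that radial_profileD(3)[OF P, of s] by (simp add: u_def)
  have left: "u s = 1" if "s \<le> a - 1" for s
    using that radial_profileD(4)[OF P, of s] by (simp add: u_def)
  show thesis
  proof (rule that)
    show "radial_profile Q u" by (rule Q(1))
    show "v s \<le> u s" for s by (simp add: u_def)
    show "Q s = P s" if "a \<le> s" for s
      by (rule radial_profile_eqI[OF Q(1) P, of "{a..}" a]) (use that right Q(2) in auto)
    show "Q s = s + (Q (a - 1) - (a - 1))" if "s \<le> a - 1" for s
      by (rule radial_profile_eqI[OF Q(1) radial_profile_ident_plus, of "{..a - 1}" "a - 1"])
        (use that left in auto)
  qed
qed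

lemma exists_radial_profile_between:
  assumes f: "mono f" "\<And>s. 0 < f s" "\<And>s. f s \<le> 1" "\<And>s. - 1 \<le> s \<Longrightarrow> f s = 1"
  obtains P v where "radial_profile P v" "\<And>s. 0 \<le> s \<Longrightarrow> P s = s" "\<And>s. f (s - 1) \<le> v s" "\<And>s. v s \<le> f s"
proof -
  define v where "v s = integral {s - 1..s} f" for s
  have between: "f (s - 1) \<le> v s" "v s \<le> f s" for s
    unfolding v_def by (rule moving_average_bounds[OF f(1)])+
  have bounds: "0 < v s" "v s \<le> 1" for s
    using between[of s] f(2)[of "s - 1"] f(3)[of s] by linarith+
  have one: "v s = 1" if "0 \<le> s" for s
    using between[of s] f(4)[of s] f(4)[of "s - 1"] that by simp
  have cont: "continuous_on UNIV v"
    unfolding v_def using f(1)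
    by (intro continuous_on_moving_average integrable_on_mono_on) (auto simp: mono_on_def mono_def)
  obtain P where P: "radial_profile P v" "P 0 = 0"
    using exists_radial_profile[of v 0 0, OF cont bounds] by blast
  have "P s = s" if "0 \<le> s" for s
    using radial_profile_eqI[OF P(1) radial_profile_ident_plus[of 0], of "{0..}" 0 s] one P(2) that by auto
  then show thesis
    using P(1) between by (intro that)
qed

lemma nn_integral_exp_substitution:
  fixes h :: "real \<Rightarrow> real"
  assumes "h \<in> borel_measurable borel" "0 \<le> t"
  shows "(\<integral>\<^sup>+s\<in>{0..t}. ennreal (h (exp s)) \<partial>lborel) = (\<integral>\<^sup>+\<tau>\<in>{1..exp t}. ennreal (h \<tau> / \<tau>) \<partial>lborel)"
proof -
  have "(\<integral>\<^sup>+\<tau>. ennreal (h \<tau> / \<tau> * indicator {exp 0..exp t} \<tau>) \<partial>lborel)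
      = (\<integral>\<^sup>+s. ennreal (h (exp s) / exp s * exp s * indicator {0..t} s) \<partial>lborel)"
    using assms by (intro nn_integral_substitution)
      (auto simp: set_borel_measurable_def intro!: DERIV_exp continuous_intros)
  then show ?thesis by (simp add: nn_integral_set_ennreal)
qed

lemma radial_profile_lower_bound:
  assumes P: "radial_profile P v" "P 0 = 0" and "s \<le> 0" "0 \<le> L"
    and w: "antimono w" "\<And>s. v s \<le> w (exp (- s))"
    and L: "(\<integral>\<^sup>+\<tau>\<in>{1..}. ennreal (w \<tau> / \<tau>) \<partial>lborel) \<le> ennreal L"
  shows "- L \<le> P s"
proof -
  have v: "continuous_on UNIV (\<lambda>s. v (- s))"
    by (rule continuous_on_compose2[OF radial_profileD(1)[OF P(1)]]) (auto intro!: continuous_intros)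
  have "ennreal (- P (- (- s)) - - P (- 0)) = (\<integral>\<^sup>+t\<in>{0..- s}. ennreal (v (- t)) \<partial>lborel)"
  proof (rule nn_integral_FTC_Icc[symmetric])
    show "((\<lambda>t. - P (- t)) has_real_derivative v (- t)) (at t)" for t
      using DERIV_minus[OF DERIV_chain2[OF radial_profileD(2)[OF P(1)] DERIV_minus[OF DERIV_ident]]]
      by simp
  qed (use assms(3) radial_profileD(3)[OF P(1)] borel_measurable_continuous_onI[OF v] in
      \<open>auto simp: less_imp_le\<close>)
  also have "\<dots> \<le> (\<integral>\<^sup>+t\<in>{0..- s}. ennreal (w (exp t)) \<partial>lborel)"
    using w(2)[of "- t" for t] by (intro nn_integral_mono mult_right_mono ennreal_leI) simp_all
  also have "\<dots> = (\<integral>\<^sup>+\<tau>\<in>{1..exp (- s)}. ennreal (w \<tau> / \<tau>) \<partial>lborel)"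
    using assms(3) by (intro nn_integral_exp_substitution borel_measurable_antimono w(1)) simp
  also have "\<dots> \<le> (\<integral>\<^sup>+\<tau>\<in>{1..}. ennreal (w \<tau> / \<tau>) \<partial>lborel)"
    by (intro nn_integral_mono) (auto split: split_indicator)
  also note L
  finally show ?thesis using P(2) assms(4) by simp
qed

definition dilatation_bound :: "(ennreal \<Rightarrow> ennreal) \<Rightarrow> nat \<Rightarrow> (real \<Rightarrow> real) \<Rightarrow> real \<Rightarrow> bool" where
  "dilatation_bound \<Phi> k v C \<longleftrightarrow> 0 \<le> C \<and> (\<forall>s. \<Phi> (ennreal (1 / v s ^ k)) \<le> ennreal (C * exp \<bar>s\<bar>))"

lemma dilatation_bound_reparam:
  assumes "dilatation_bound \<Phi> k v C" and "\<And>s. \<bar>f s\<bar> \<le> \<bar>a\<bar> + \<bar>s\<bar>"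
  shows "dilatation_bound \<Phi> k (\<lambda>s. v (f s)) (C * exp \<bar>a\<bar>)"
  unfolding dilatation_bound_def
proof (intro conjI allI)
  have C: "0 \<le> C" using assms(1) by (simp add: dilatation_bound_def)
  then show "0 \<le> C * exp \<bar>a\<bar>" by simp
  fix s
  have "\<Phi> (ennreal (1 / v (f s) ^ k)) \<le> ennreal (C * exp \<bar>f s\<bar>)"
    using assms(1) by (simp add: dilatation_bound_def)
  also have "\<dots> \<le> ennreal (C * exp (\<bar>a\<bar> + \<bar>s\<bar>))"
    using C assms(2) by (intro ennreal_leI mult_left_mono) auto
  finally show "\<Phi> (ennreal (1 / v (f s) ^ k)) \<le> ennreal (C * exp \<bar>a\<bar> * exp \<bar>s\<bar>)"
    by (simp add: exp_add mult.assoc)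
qed

lemma dilatation_bound_mono:
  assumes "dilatation_bound \<Phi> k v C" "mono \<Phi>" and "\<And>s. 0 < v s" "\<And>s. v s \<le> u s"
  shows "dilatation_bound \<Phi> k u C"
  unfolding dilatation_bound_def
proof (intro conjI allI)
  fix s
  have "1 / u s ^ k \<le> 1 / v s ^ k"
    using assms(3,4)[of s] by (intro divide_left_mono power_mono mult_pos_pos zero_less_power) auto
  then have "\<Phi> (ennreal (1 / u s ^ k)) \<le> \<Phi> (ennreal (1 / v s ^ k))"
    by (intro monoD[OF assms(2)] ennreal_leI)
  also have "\<dots> \<le> ennreal (C * exp \<bar>s\<bar>)"
    using assms(1) by (simp add: dilatation_bound_def)
  finally show "\<Phi> (ennreal (1 / u s ^ k)) \<le> ennreal (C * exp \<bar>s\<bar>)" .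
qed (use assms(1) in \<open>simp add: dilatation_bound_def\<close>)

lemma dilatation_bound_if_density_le:
  assumes mono: "mono \<Phi>" and finite: "\<Phi> 1 \<noteq> \<infinity>" and \<alpha>: "\<alpha> * real k = 1"
    and v: "\<And>s. dilatation_density \<Phi> \<alpha> (exp (1 - s)) \<le> v s"
  shows "dilatation_bound \<Phi> k v (max (enn2real (\<Phi> 1)) (exp 1))" (is "dilatation_bound \<Phi> k v ?C")
  unfolding dilatation_bound_def
proof (intro conjI allI)
  fix s :: real
  let ?\<tau> = "exp (1 - s)"
  have "1 / v s ^ k \<le> 1 / dilatation_density \<Phi> \<alpha> ?\<tau> ^ k"
    using v[of s] dilatation_density_pos[of \<Phi> \<alpha> ?\<tau>]
    by (intro divide_left_mono power_mono mult_pos_pos zero_less_power) auto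
  then have "\<Phi> (ennreal (1 / v s ^ k)) \<le> \<Phi> (ennreal (truncated_inverse \<Phi> ?\<tau>))"
    unfolding inverse_power_dilatation_density[OF \<alpha>] by (intro monoD[OF mono] ennreal_leI)
  also have "\<dots> \<le> max (\<Phi> 1) (ennreal ?\<tau>)"
    by (rule Phi_truncated_inverse_le)
  also have "\<dots> = ennreal (max (enn2real (\<Phi> 1)) ?\<tau>)"
    using finite by (simp add: less_top max_def ennreal_le_iff2)
  also have "\<dots> \<le> ennreal (?C * exp \<bar>s\<bar>)"
  proof (intro ennreal_leI max.boundedI)
    have "enn2real (\<Phi> 1) * 1 \<le> ?C * exp \<bar>s\<bar>"
      by (intro mult_mono) (auto simp: le_max_iff_disj)
    then show "enn2real (\<Phi> 1) \<le> ?C * exp \<bar>s\<bar>" by simp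
    have "exp 1 * exp (- s) \<le> ?C * exp \<bar>s\<bar>"
      by (intro mult_mono) (auto simp: le_max_iff_disj)
    then show "?\<tau> \<le> ?C * exp \<bar>s\<bar>"
      by (simp flip: exp_add)
  qed
  finally show "\<Phi> (ennreal (1 / v s ^ k)) \<le> ennreal (?C * exp \<bar>s\<bar>)" .
qed (simp add: le_max_iff_disj)

definition cavitating_profile ::
  "(ennreal \<Rightarrow> ennreal) \<Rightarrow> nat \<Rightarrow> (real \<Rightarrow> real) \<Rightarrow> (real \<Rightarrow> real) \<Rightarrow> real \<Rightarrow> real \<Rightarrow> bool" where
  "cavitating_profile \<Phi> k P v L C \<longleftrightarrow> radial_profile P v \<and> (\<forall>s\<ge>0. P s = s) \<and> (\<forall>s. - L \<le> P s) \<and>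
     dilatation_bound \<Phi> k v C"

lemma cavitating_profileD:
  assumes "cavitating_profile \<Phi> k P v L C"
  shows "radial_profile P v" "\<And>s. 0 \<le> s \<Longrightarrow> P s = s" "\<And>s. - L \<le> P s" "dilatation_bound \<Phi> k v C"
  using assms by (auto simp: cavitating_profile_def)

lemma exists_cavitating_profile:
  fixes \<Phi> :: "ennreal \<Rightarrow> ennreal"
  assumes n: "2 \<le> n" and mono: "mono \<Phi>"
    and fin: "(\<integral>\<^sup>+\<tau>\<in>{\<delta><..}. gen_inv_integrand \<Phi> (1 / (real n - 1)) \<tau> \<partial>lborel) \<noteq> \<infinity>"
  obtains P v L C where "cavitating_profile \<Phi> (n - 1) P v L C"
proof -
  define \<alpha> where "\<alpha> = 1 / (real n - 1)"
  have \<alpha>: "0 < \<alpha>" "\<alpha> * real (n - 1) = 1" using n by (auto simp: \<alpha>_def of_nat_diff)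
  define w where "w = dilatation_density \<Phi> \<alpha>"
  have w: "antimono w"
    unfolding w_def using \<alpha>(1) by (intro dilatation_density_antimono) simp
  have "mono (\<lambda>s. w (exp (- s)))"
    using antimonoD[OF w] by (auto simp: mono_def)
  then obtain P v where P: "radial_profile P v" "\<And>s. 0 \<le> s \<Longrightarrow> P s = s"
    and v: "\<And>s. w (exp (- (s - 1))) \<le> v s" "\<And>s. v s \<le> w (exp (- s))"
    using \<alpha>(1) exists_radial_profile_between[of "\<lambda>s. w (exp (- s))"]
    by (auto simp: w_def dilatation_density_pos dilatation_density_le_1 dilatation_density_eq_1)
  define L where "L = enn2real (\<integral>\<^sup>+\<tau>\<in>{1..}. ennreal (w \<tau> / \<tau>) \<partial>lborel)"
  have L: "0 \<le> L" "(\<integral>\<^sup>+\<tau>\<in>{1..}. ennreal (w \<tau> / \<tau>) \<partial>lborel) \<le> ennreal L"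
    using nn_integral_dilatation_density_finite[OF \<alpha>(1) fin[folded \<alpha>_def]]
    by (simp_all add: L_def w_def less_top)
  have lower: "- L \<le> P s" for s
  proof (cases "0 \<le> s")
    case False
    then show ?thesis
      using P L by (intro radial_profile_lower_bound[OF P(1) _ _ L(1) w v(2) L(2)]) auto
  qed (use P(2)[of s] L(1) in auto)
  have "dilatation_bound \<Phi> (n - 1) v (max (enn2real (\<Phi> 1)) (exp 1))"
    using gen_inv_integral_finite_imp_finite_at_1[OF less_imp_le fin[folded \<alpha>_def]] v(1) \<alpha>(1)
    by (intro dilatation_bound_if_density_le[OF mono _ \<alpha>(2)]) (auto simp: w_def)
  then have "cavitating_profile \<Phi> (n - 1) P v L (max (enn2real (\<Phi> 1)) (exp 1))"
    using P lower by (simp add: cavitating_profile_def)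
  then show thesis by (rule that)
qed

section \<open>Axial stretches and their dilatation\<close>

definition axial_stretch :: "real \<Rightarrow> real \<Rightarrow> 'a::real_inner \<Rightarrow> 'a \<Rightarrow> 'a" where
  "axial_stretch a w e v = a *\<^sub>R (v + ((w - 1) * (e \<bullet> v)) *\<^sub>R e)"

lemma linear_axial_stretch: "linear (axial_stretch a w e)"
  unfolding axial_stretch_def by (intro linearI) (auto simp: algebra_simps inner_add_right)

lemma axial_stretch_orthogonal_transformation:
  assumes "orthogonal_transformation f"
  shows "axial_stretch a w (f e) (f v) = f (axial_stretch a w e v)"
  using assms
  by (simp add: axial_stretch_def orthogonal_transformation_def linear_add linear_scale)

lemma det_axial_stretch_axis:
  "det (matrix (axial_stretch a w (axis k 1 :: real^'n))) = a ^ CARD('n) * w"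
proof -
  have axis_nth_if: "(axis i 1 :: real^'n) $ j = (if j = i then 1 else 0)" for i j
    by (simp add: axis_def)
  have "det (matrix (axial_stretch a w (axis k 1 :: real^'n))) = (\<Prod>i\<in>UNIV. a * (if i = k then w else 1))"
    by (subst det_diagonal)
      (auto simp: matrix_def axial_stretch_def inner_axis' axis_nth_if intro!: prod.cong)
  then show ?thesis by (simp add: prod.distrib)
qed

lemma det_axial_stretch:
  fixes e :: "real^'n"
  assumes "norm e = 1"
  shows "det (matrix (axial_stretch a w e)) = a ^ CARD('n) * w"
proof -
  define k :: 'n where "k = undefined"
  obtain f :: "real^'n \<Rightarrow> real^'n" where f: "orthogonal_transformation f" "f (axis k 1) = e"
    using orthogonal_transformation_exists_1[of "axis k 1" e] assms by auto
  have "axial_stretch a w e \<circ> f = f \<circ> axial_stretch a w (axis k 1)"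
    using axial_stretch_orthogonal_transformation[OF f(1), of a w "axis k 1"] by (auto simp: f(2))
  then have "matrix (axial_stretch a w e) ** matrix f = matrix f ** matrix (axial_stretch a w (axis k 1))"
    using orthogonal_transformation_linear[OF f(1)] linear_axial_stretch by (metis matrix_compose)
  then have "det (matrix (axial_stretch a w e)) * det (matrix f)
      = det (matrix f) * det (matrix (axial_stretch a w (axis k 1 :: real^'n)))"
    by (metis det_mul)
  moreover have "det (matrix f) \<noteq> 0"
    using orthogonal_transformation_det[OF f(1)] by auto
  ultimately show ?thesis by (simp add: det_axial_stretch_axis)
qed

lemma norm_axial_stretch_ge:
  assumes e: "norm e = 1" and "0 \<le> a" "0 \<le> w" "w \<le> 1"
  shows "a * w * norm v \<le> norm (axial_stretch a w e v)"
proof -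
  let ?u = "v + ((w - 1) * (e \<bullet> v)) *\<^sub>R e"
  have "(e \<bullet> v)\<^sup>2 \<le> (norm v)\<^sup>2"
    using Cauchy_Schwarz_ineq[of e v] e by (simp add: power2_norm_eq_inner norm_eq_1)
  moreover have "w\<^sup>2 \<le> 1" using assms by (simp add: power_le_one)
  ultimately have "(1 - w\<^sup>2) * (e \<bullet> v)\<^sup>2 \<le> (1 - w\<^sup>2) * (norm v)\<^sup>2"
    by (intro mult_left_mono) auto
  moreover have "(norm ?u)\<^sup>2 = (norm v)\<^sup>2 - (1 - w\<^sup>2) * (e \<bullet> v)\<^sup>2"
    using e unfolding power2_norm_eq_inner norm_eq_1
    by (simp add: inner_add_left inner_add_right inner_commute[of v e] power2_eq_square algebra_simps)
  ultimately have "(w * norm v)\<^sup>2 \<le> (norm ?u)\<^sup>2"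
    by (simp add: power_mult_distrib algebra_simps)
  then have "w * norm v \<le> norm ?u" by (rule power2_le_imp_le) simp
  then have "a * (w * norm v) \<le> a * norm ?u" using assms(2) by (rule mult_left_mono)
  then show ?thesis using assms(2) by (simp add: axial_stretch_def mult.assoc)
qed

lemma min_stretch_axial_stretch:
  assumes e: "norm e = 1" and "0 \<le> a" "0 \<le> w" "w \<le> 1"
  shows "min_stretch (axial_stretch a w e) = a * w"
  unfolding min_stretch_def
proof (rule antisym)
  show "(INF v\<in>{v. v \<noteq> 0}. norm (axial_stretch a w e v) / norm v) \<le> a * w"
  proof (rule cINF_lower2)
    show "bdd_below ((\<lambda>v. norm (axial_stretch a w e v) / norm v) ` {v. v \<noteq> 0})"
      by (rule bdd_belowI[of _ 0]) auto
    show "e \<in> {v. v \<noteq> 0}" using e by auto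
    have "axial_stretch a w e e = (a * w) *\<^sub>R e"
      using e by (simp add: axial_stretch_def norm_eq_1 algebra_simps)
    then show "norm (axial_stretch a w e e) / norm e \<le> a * w" using assms by simp
  qed
  have "e \<noteq> 0" using e by auto
  then show "a * w \<le> (INF v\<in>{v. v \<noteq> 0}. norm (axial_stretch a w e v) / norm v)"
    using norm_axial_stretch_ge[OF assms] by (intro cINF_greatest) (auto simp: pos_le_divide_eq)
qed

lemma K_I_axial_stretch:
  fixes e :: "real^'n"
  assumes "norm e = 1" "0 < a" "0 < w" "w \<le> 1"
    and "(g has_derivative axial_stretch a w e) (at x)"
  shows "K_I g x = ennreal (1 / w ^ (CARD('n) - 1))"
proof -
  have "frechet_derivative g (at x) = axial_stretch a w e"
    using frechet_derivative_at[OF assms(5)] by simp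
  moreover have "g differentiable at x" using assms(5) by (auto simp: differentiable_def)
  moreover have "a ^ CARD('n) * w / (a * w) ^ CARD('n) = 1 / w ^ (CARD('n) - 1)"
    using assms(2,3) zero_less_card_finite[where 'a='n]
    by (cases "CARD('n)") (auto simp: power_mult_distrib)
  ultimately show ?thesis
    using assms by (simp add: K_I_def Let_def det_axial_stretch min_stretch_axial_stretch abs_mult)
qed

lemma K_I_cong_open:
  fixes g h :: "real^'n \<Rightarrow> real^'n"
  assumes "open U" "x \<in> U" "\<And>y. y \<in> U \<Longrightarrow> g y = h y"
  shows "K_I g x = K_I h x"
proof -
  have "(g has_derivative A) (at x) \<longleftrightarrow> (h has_derivative A) (at x)" for A
    using assms has_derivative_transform_within_open[of g A x UNIV U h]
      has_derivative_transform_within_open[of h A x UNIV U g] by auto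
  then show ?thesis
    unfolding K_I_def frechet_derivative_def differentiable_def by simp
qed

definition regular_at :: "(real^'n \<Rightarrow> real^'n) \<Rightarrow> real^'n \<Rightarrow> bool" where
  "regular_at g x \<longleftrightarrow> (\<exists>U g' \<kappa>. open U \<and> x \<in> U \<and>
     (\<forall>y\<in>U. (g has_derivative g' y) (at y) \<and> K_I g y = ennreal (\<kappa> y)) \<and>
     continuous_on U \<kappa> \<and> (\<forall>b. continuous_on U (\<lambda>y. g' y b)))"

lemma regular_atI:
  assumes "open U" "x \<in> U" "\<And>y. y \<in> U \<Longrightarrow> (g has_derivative g' y) (at y)"
    "\<And>y. y \<in> U \<Longrightarrow> K_I g y = ennreal (\<kappa> y)" "continuous_on U \<kappa>" "\<And>b. continuous_on U (\<lambda>y. g' y b)"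
  shows "regular_at g x"
  using assms unfolding regular_at_def by blast

lemma regular_atE:
  assumes "regular_at g x"
  obtains U g' \<kappa> where "open U" "x \<in> U" "\<And>y. y \<in> U \<Longrightarrow> (g has_derivative g' y) (at y)"
    "\<And>y. y \<in> U \<Longrightarrow> K_I g y = ennreal (\<kappa> y)" "continuous_on U \<kappa>" "\<And>b. continuous_on U (\<lambda>y. g' y b)"
  using assms unfolding regular_at_def by blast

lemma regular_at_cong_open:
  assumes V: "open V" "x \<in> V" "\<And>y. y \<in> V \<Longrightarrow> g y = h y" and "regular_at g x"
  shows "regular_at h x"
proof -
  obtain U g' \<kappa> where U: "open U" "x \<in> U" "\<And>y. y \<in> U \<Longrightarrow> (g has_derivative g' y) (at y)"
    "\<And>y. y \<in> U \<Longrightarrow> K_I g y = ennreal (\<kappa> y)" "continuous_on U \<kappa>" "\<And>b. continuous_on U (\<lambda>y. g' y b)"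
    using assms(4) by (rule regular_atE) (rule that)
  show ?thesis
  proof (rule regular_atI)
    show "(h has_derivative g' y) (at y)" if "y \<in> U \<inter> V" for y
      using that U(3)[of y] V has_derivative_transform_within_open[of g "g' y" y UNIV V h] by auto
    show "K_I h y = ennreal (\<kappa> y)" if "y \<in> U \<inter> V" for y
      using that U(4)[of y] K_I_cong_open[of V y g h] V by auto
  qed (use U V in \<open>auto intro: continuous_on_subset\<close>)
qed

lemma regular_at_isCont: "regular_at g x \<Longrightarrow> isCont g x"
  by (auto elim!: regular_atE intro: has_derivative_continuous)

lemma scaling_has_derivative_axial_stretch:
  fixes c e :: "'a::euclidean_space"
  shows "((\<lambda>x. c + a *\<^sub>R (x - c)) has_derivative axial_stretch a 1 e) (at y)"
  unfolding axial_stretch_def by (auto intro!: derivative_eq_intros)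

lemma K_I_scaling:
  fixes c :: "real^'n"
  assumes "0 < a"
  shows "K_I (\<lambda>x. c + a *\<^sub>R (x - c)) y = 1"
proof -
  obtain e :: "real^'n" where "norm e = 1" using vector_choose_size zero_le_one by blast
  then show ?thesis
    using K_I_axial_stretch[OF _ assms _ _ scaling_has_derivative_axial_stretch] by fastforce
qed

lemma regular_at_scaling:
  fixes c :: "real^'n"
  assumes "0 < a"
  shows "regular_at (\<lambda>x. c + a *\<^sub>R (x - c)) y"
  by (rule regular_atI[of UNIV _ _ "\<lambda>_. axial_stretch a 1 0" "\<lambda>_. 1"])
    (use K_I_scaling[OF assms] scaling_has_derivative_axial_stretch in auto)

section \<open>Radial maps\<close>

definition radial_map :: "'a::euclidean_space \<Rightarrow> (real \<Rightarrow> real) \<Rightarrow> 'a \<Rightarrow> 'a" where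
  "radial_map c P x = c + exp (P (ln (norm (x - c))) - ln (norm (x - c))) *\<^sub>R (x - c)"

lemma radial_map_center [simp]: "radial_map c P c = c"
  by (simp add: radial_map_def)

lemma norm_radial_map: "x \<noteq> c \<Longrightarrow> norm (radial_map c P x - c) = exp (P (ln (norm (x - c))))"
  by (simp add: radial_map_def exp_diff)

lemma radial_map_ident: "P (ln (norm (x - c))) = ln (norm (x - c)) \<Longrightarrow> radial_map c P x = x"
  by (simp add: radial_map_def)

lemma radial_map_eq_scaling:
  assumes "\<And>s. s < ln \<delta> \<Longrightarrow> P s = s + q" "norm (x - c) < \<delta>"
  shows "radial_map c P x = c + exp q *\<^sub>R (x - c)"
proof (cases "x = c")
  case False
  then have "ln (norm (x - c)) < ln \<delta>"
    using assms(2) by (intro ln_strict_mono) auto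
  then show ?thesis by (simp add: radial_map_def assms(1))
qed simp

lemma inj_radial_map:
  assumes "strict_mono P"
  shows "inj (radial_map c P)"
proof (rule injI)
  fix x y assume eq: "radial_map c P x = radial_map c P y"
  show "x = y"
  proof (cases "x = c \<or> y = c")
    case True
    then show ?thesis
      using eq norm_radial_map[of x c P] norm_radial_map[of y c P] by force
  next
    case False
    then have "P (ln (norm (x - c))) = P (ln (norm (y - c)))"
      using eq norm_radial_map[of x c P] norm_radial_map[of y c P] by simp
    then have "norm (x - c) = norm (y - c)"
      using False strict_mono_eq[OF assms] by simp
    then show ?thesis using eq by (simp add: radial_map_def)
  qed
qed

lemma has_derivative_radial_scaling:
  fixes c :: "'a::real_inner"
  assumes "x \<noteq> c" "(\<phi> has_real_derivative D) (at (norm (x - c)))"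
  shows "((\<lambda>x. c + \<phi> (norm (x - c)) *\<^sub>R (x - c)) has_derivative
    (\<lambda>v. \<phi> (norm (x - c)) *\<^sub>R v + (D * (sgn (x - c) \<bullet> v)) *\<^sub>R (x - c))) (at x)"
proof -
  have shift: "((\<lambda>x. x - c) has_derivative (\<lambda>v. v)) (at x)"
    by (auto intro!: derivative_eq_intros)
  have "((\<lambda>x. norm (x - c)) has_derivative (\<lambda>v. sgn (x - c) \<bullet> v)) (at x)"
    using has_derivative_compose[OF shift has_derivative_norm] assms(1) by (simp add: inner_commute)
  from has_derivative_compose[OF this assms(2)[unfolded has_field_derivative_def]]
  have "((\<lambda>x. \<phi> (norm (x - c))) has_derivative (\<lambda>v. D * (sgn (x - c) \<bullet> v))) (at x)" .
  from has_derivative_add[OF has_derivative_const has_derivative_scaleR[OF this shift], of c]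
  show ?thesis by simp
qed

lemma radial_map_has_derivative:
  fixes c x :: "'a::euclidean_space"
  defines "s \<equiv> ln (norm (x - c))"
  assumes "x \<noteq> c" "(P has_real_derivative w) (at s)"
  shows "(radial_map c P has_derivative axial_stretch (exp (P s - s)) w (sgn (x - c))) (at x)"
proof -
  define r where "r = norm (x - c)"
  have r: "0 < r" "s = ln r" using assms(2) by (simp_all add: r_def s_def)
  have "(ln has_real_derivative 1 / r) (at r)"
    using r by (auto intro!: derivative_eq_intros)
  from DERIV_fun_exp[OF DERIV_diff[OF DERIV_chain2[of P, OF _ this] this]]
  have "((\<lambda>r. exp (P (ln r) - ln r)) has_real_derivative exp (P s - s) * (w * (1 / r) - 1 / r)) (at r)"
    using assms(3) by (simp add: r)
  from has_derivative_radial_scaling[OF assms(2) this[unfolded r_def]]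
  have "(radial_map c P has_derivative (\<lambda>v. exp (P s - s) *\<^sub>R v +
      (exp (P s - s) * (w * (1 / r) - 1 / r) * (sgn (x - c) \<bullet> v)) *\<^sub>R (x - c))) (at x)"
    by (simp add: radial_map_def[abs_def] s_def r_def)
  moreover have "exp (P s - s) *\<^sub>R v +
      (exp (P s - s) * (w * (1 / r) - 1 / r) * (sgn (x - c) \<bullet> v)) *\<^sub>R (x - c)
      = axial_stretch (exp (P s - s)) w (sgn (x - c)) v" for v
    using r(1)
    by (simp add: axial_stretch_def sgn_div_norm[of "x - c"] scaleR_add_right field_simps flip: r_def)
  ultimately show ?thesis by simp
qed

lemma K_I_radial_map:
  fixes c :: "real^'n"
  assumes P: "radial_profile P v" and "x \<noteq> c"
  shows "K_I (radial_map c P) x = ennreal (1 / v (ln (norm (x - c))) ^ (CARD('n) - 1))"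
  using assms(2) radial_profileD[OF P]
  by (intro K_I_axial_stretch[OF _ _ _ _ radial_map_has_derivative]) (auto simp: norm_sgn)

lemma regular_at_radial_map:
  fixes c :: "real^'n"
  assumes P: "radial_profile P v" and "x \<noteq> c"
  shows "regular_at (radial_map c P) x"
proof (rule regular_atI)
  let ?s = "\<lambda>y. ln (norm (y - c))"
  show "open (- {c})" "x \<in> - {c}" using assms(2) by auto
  show "(radial_map c P has_derivative axial_stretch (exp (P (?s y) - ?s y)) (v (?s y)) (sgn (y - c))) (at y)"
    if "y \<in> - {c}" for y
    using that radial_profileD(2)[OF P] by (intro radial_map_has_derivative) auto
  show "K_I (radial_map c P) y = ennreal (1 / v (?s y) ^ (CARD('n) - 1))" if "y \<in> - {c}" for y
    using that by (intro K_I_radial_map[OF P]) simp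
  have cont_s: "continuous_on (- {c}) ?s" by (intro continuous_intros) auto
  have "continuous_on UNIV P"
    using radial_profileD(2)[OF P] by (meson DERIV_isCont continuous_at_imp_continuous_on)
  then have cont_P: "continuous_on (- {c}) (\<lambda>y. P (?s y))"
    by (rule continuous_on_compose2[OF _ cont_s]) simp
  have cont_v: "continuous_on (- {c}) (\<lambda>y. v (?s y))"
    by (rule continuous_on_compose2[OF radial_profileD(1)[OF P] cont_s]) simp
  show "continuous_on (- {c}) (\<lambda>y. 1 / v (?s y) ^ (CARD('n) - 1))"
    using radial_profileD(3)[OF P] by (intro continuous_intros cont_v) (metis less_irrefl power_not_zero)
  show "continuous_on (- {c}) (\<lambda>y. axial_stretch (exp (P (?s y) - ?s y)) (v (?s y)) (sgn (y - c)) b)" for b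
    unfolding axial_stretch_def by (intro continuous_intros cont_P cont_v) auto
qed

lemma regular_at_radial_map_everywhere:
  fixes c :: "real^'n"
  assumes P: "radial_profile P v" and "0 < \<delta>" "\<And>s. s < ln \<delta> \<Longrightarrow> P s = s + q"
  shows "regular_at (radial_map c P) x"
proof (cases "x = c")
  case True
  have "c + exp q *\<^sub>R (y - c) = radial_map c P y" if "y \<in> ball c \<delta>" for y
    using that assms(3)
    by (intro radial_map_eq_scaling[symmetric]) (auto simp: dist_norm norm_minus_commute)
  then show ?thesis
    using True assms(2)
    by (intro regular_at_cong_open[OF open_ball _ _ regular_at_scaling[of "exp q" c], of x c \<delta>]) auto
qed (rule regular_at_radial_map[OF P])

lemma exp_abs_ln_le: "0 < r \<Longrightarrow> exp \<bar>ln r\<bar> \<le> r + 1 / (r::real)"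
  by (auto simp: abs_real_def exp_minus inverse_eq_divide)

lemma Phi_K_I_radial_map_le:
  fixes c :: "real^'n"
  assumes P: "radial_profile P v" and bound: "dilatation_bound \<Phi> (CARD('n) - 1) v C" and "x \<noteq> c"
  shows "\<Phi> (K_I (radial_map c P) x) \<le> ennreal (C * pole_weight c x)"
proof -
  have "\<Phi> (K_I (radial_map c P) x) \<le> ennreal (C * exp \<bar>ln (norm (x - c))\<bar>)"
    using bound by (simp add: K_I_radial_map[OF P assms(3)] dilatation_bound_def)
  also have "\<dots> \<le> ennreal (C * pole_weight c x)"
    using bound assms(3) unfolding pole_weight_def dilatation_bound_def
    by (intro ennreal_leI mult_left_mono exp_abs_ln_le) auto
  finally show ?thesis .
qed

section \<open>Weak derivatives of continuously differentiable maps\<close>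

lemma integrable_on_compact_support:
  fixes f :: "'a::euclidean_space \<Rightarrow> 'b::{banach, second_countable_topology}"
  assumes "compact K" "K \<subseteq> S" "continuous_on S f" "\<And>x. x \<in> S - K \<Longrightarrow> f x = 0"
  shows "integrable lborel (\<lambda>x. indicator S x *\<^sub>R f x)"
proof -
  have "integrable lborel (\<lambda>x. indicator K x *\<^sub>R f x)"
    using assms by (intro borel_integrable_compact) (auto intro: continuous_on_subset)
  moreover have "indicator K x *\<^sub>R f x = indicator S x *\<^sub>R f x" for x
    using assms(2,4) by (auto simp: indicator_def)
  ultimately show ?thesis by simp
qed

lemma integral_lborel_translation:
  fixes f :: "'a::euclidean_space \<Rightarrow> 'b::{banach, second_countable_topology}"
  assumes "f \<in> borel_measurable borel"
  shows "integral\<^sup>L lborel (\<lambda>x. f (x + a)) = integral\<^sup>L lborel f"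
    and "integrable lborel (\<lambda>x. f (x + a)) \<longleftrightarrow> integrable lborel f"
proof -
  have "integral\<^sup>L (distr lborel borel ((+) a)) f = integral\<^sup>L lborel (\<lambda>x. f (a + x))"
    by (rule integral_distr) (use assms in auto)
  then show "integral\<^sup>L lborel (\<lambda>x. f (x + a)) = integral\<^sup>L lborel f"
    by (simp add: lborel_distr_plus add.commute)
  have "integrable (distr lborel borel ((+) a)) f \<longleftrightarrow> integrable lborel (\<lambda>x. f (a + x))"
    by (rule integrable_distr_eq) (use assms in auto)
  then show "integrable lborel (\<lambda>x. f (x + a)) \<longleftrightarrow> integrable lborel f"
    by (simp add: lborel_distr_plus add.commute)
qed

lemma integral_line_derivative:
  fixes \<psi> :: "'a::euclidean_space \<Rightarrow> 'b::euclidean_space"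
  assumes der: "\<And>x. (\<psi> has_derivative \<psi>' x) (at x)" and cont: "continuous_on UNIV (\<lambda>x. \<psi>' x b)"
  shows "integral\<^sup>L lborel (\<lambda>t. indicator {0..1} t *\<^sub>R \<psi>' (x + t *\<^sub>R b) b) = \<psi> (x + b) - \<psi> x"
proof -
  have "((\<lambda>t. \<psi> (x + t *\<^sub>R b)) has_vector_derivative \<psi>' (x + t *\<^sub>R b) b) (at t within {0..1})" for t
  proof -
    have "((\<lambda>t. x + t *\<^sub>R b) has_derivative (\<lambda>s. s *\<^sub>R b)) (at t within {0..1})"
      by (auto intro!: derivative_eq_intros)
    from has_derivative_compose[OF this der]
    show ?thesis
      by (simp add: has_vector_derivative_def linear_scale[OF has_derivative_linear[OF der]])
  qed
  moreover have "continuous_on {0..1} (\<lambda>t. \<psi>' (x + t *\<^sub>R b) b)"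
    by (rule continuous_on_compose2[OF cont]) (auto intro!: continuous_intros)
  ultimately show ?thesis
    using integral_FTC_Icc[of 0 1 "\<lambda>t. \<psi> (x + t *\<^sub>R b)" "\<lambda>t. \<psi>' (x + t *\<^sub>R b) b"] by simp
qed

text \<open>Integrate \<open>\<psi>(x + b) - \<psi>(x) = \<integral>\<^sub>0\<^sup>1 \<partial>\<^sub>b \<psi>(x + t b) dt\<close> over \<open>x\<close> and exchange the integrals: by translation
  invariance the left side gives 0 and the right side the integral of \<open>\<partial>\<^sub>b \<psi>\<close>.\<close>

lemma integral_directional_derivative_eq_0:
  fixes \<psi> :: "'a::euclidean_space \<Rightarrow> 'b::euclidean_space"
  assumes der: "\<And>x. (\<psi> has_derivative \<psi>' x) (at x)"
    and cont: "continuous_on UNIV (\<lambda>x. \<psi>' x b)"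
    and K: "compact K" "\<And>x. x \<notin> K \<Longrightarrow> \<psi> x = 0" "\<And>x. x \<notin> K \<Longrightarrow> \<psi>' x b = 0"
  shows "integral\<^sup>L lborel (\<lambda>x. \<psi>' x b) = 0"
proof -
  define F where "F x t = indicator {0..1} t *\<^sub>R \<psi>' (x + t *\<^sub>R b) b" for x and t :: real
  define T where "T = (\<lambda>(x, t). (x - t *\<^sub>R b, t)) ` (K \<times> {0..1::real})"
  have "compact T"
    unfolding T_def using K(1)
    by (intro compact_continuous_image compact_Times) (auto simp: case_prod_beta intro!: continuous_intros)
  then have "integrable lborel (\<lambda>p. indicator T p *\<^sub>R \<psi>' (fst p + snd p *\<^sub>R b) b)"
    by (intro borel_integrable_compact continuous_on_compose2[OF cont]) (auto intro!: continuous_intros)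
  moreover have F_eq: "F x t = indicator T (x, t) *\<^sub>R \<psi>' (x + t *\<^sub>R b) b" for x t
  proof (cases "t \<in> {0..1} \<and> x + t *\<^sub>R b \<in> K")
    case True
    then have "(x, t) \<in> T" by (auto simp: T_def intro!: image_eqI[of _ _ "(x + t *\<^sub>R b, t)"])
    then show ?thesis using True by (simp add: F_def)
  next
    case False
    then have "(x, t) \<notin> T" by (auto simp: T_def)
    then show ?thesis using False K(3) by (auto simp: F_def)
  qed
  ultimately have F: "integrable (lborel \<Otimes>\<^sub>M lborel) (case_prod F)"
    by (simp add: F_eq lborel_prod case_prod_beta')
  have slice: "(\<integral>x. F x t \<partial>lborel) = indicator {0..1} t *\<^sub>R integral\<^sup>L lborel (\<lambda>x. \<psi>' x b)" for t
    using integral_lborel_translation(1)[OF borel_measurable_continuous_onI[OF cont], of "t *\<^sub>R b"]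
    by (simp add: F_def)
  have c\<psi>: "continuous_on UNIV \<psi>"
    using der by (meson continuous_at_imp_continuous_on has_derivative_continuous)
  then have meas: "\<psi> \<in> borel_measurable borel" by (rule borel_measurable_continuous_onI)
  have "integrable lborel \<psi>"
    using integrable_on_compact_support[OF K(1) _ c\<psi>] K(2) by simp
  then have "(\<integral>x. \<psi> (x + b) - \<psi> x \<partial>lborel) = 0"
    using integral_lborel_translation[OF meas, of b] by simp
  moreover have "(\<integral>x. \<psi> (x + b) - \<psi> x \<partial>lborel) = (\<integral>x. (\<integral>t. F x t \<partial>lborel) \<partial>lborel)"
    by (simp add: F_def integral_line_derivative[OF der cont])
  moreover have "\<dots> = integral\<^sup>L lborel (\<lambda>x. \<psi>' x b)"
    by (simp add: slice flip: lborel_pair.Fubini_integral[OF F])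
  ultimately show ?thesis by simp
qed

lemma has_derivative_zero_extension:
  fixes f :: "'a::euclidean_space \<Rightarrow> 'b::real_normed_vector"
  assumes "open U" "closed K" "K \<subseteq> U"
    and der: "\<And>x. x \<in> U \<Longrightarrow> (f has_derivative f' x) (at x)"
    and zero: "\<And>x. x \<in> U - K \<Longrightarrow> f x = 0"
  shows "((\<lambda>x. if x \<in> U then f x else 0) has_derivative (\<lambda>v. if x \<in> U then f' x v else 0)) (at x)"
proof (cases "x \<in> U")
  case True
  have "((\<lambda>x. if x \<in> U then f x else 0) has_derivative f' x) (at x)"
    by (rule has_derivative_transform_within_open[OF der[OF True] assms(1) True]) simp
  then show ?thesis using True by simp
next
  case False
  have "((\<lambda>x. if x \<in> U then f x else 0) has_derivative (\<lambda>_. 0)) (at x)"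
    by (rule has_derivative_transform_within_open[of "\<lambda>_. 0" _ _ _ "- K"])
      (use assms False in auto)
  then show ?thesis using False by simp
qed

lemma continuous_on_zero_extension:
  fixes f :: "'a::topological_space \<Rightarrow> 'b::real_normed_vector"
  assumes "open U" "closed K" "K \<subseteq> U" "continuous_on U f" "\<And>x. x \<in> U - K \<Longrightarrow> f x = 0"
  shows "continuous_on UNIV (\<lambda>x. if x \<in> U then f x else 0)"
proof -
  have "continuous_on U (\<lambda>x. if x \<in> U then f x else 0)"
    using assms(4) by (rule continuous_on_eq) simp
  moreover have "continuous_on (- K) (\<lambda>x. if x \<in> U then f x else 0)"
    using continuous_on_const[of "- K" 0] by (rule continuous_on_eq) (use assms(5) in auto)
  ultimately have "continuous_on (U \<union> - K) (\<lambda>x. if x \<in> U then f x else 0)"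
    using assms(1,2) by (intro continuous_on_open_Un) auto
  moreover have "U \<union> - K = UNIV" using assms(3) by auto
  ultimately show ?thesis by simp
qed

lemma integral_directional_derivative_on_eq_0:
  fixes f :: "'a::euclidean_space \<Rightarrow> 'b::euclidean_space"
  assumes U: "open U" "compact K" "K \<subseteq> U"
    and der: "\<And>x. x \<in> U \<Longrightarrow> (f has_derivative f' x) (at x)" and cont: "continuous_on U (\<lambda>x. f' x b)"
    and zero: "\<And>x. x \<in> U - K \<Longrightarrow> f x = 0" "\<And>x v. x \<in> U - K \<Longrightarrow> f' x v = 0"
  shows "integral\<^sup>L lborel (\<lambda>x. indicator U x *\<^sub>R f' x b) = 0"
proof -
  have K: "closed K" using U(2) by (rule compact_imp_closed)
  have "integral\<^sup>L lborel (\<lambda>x. if x \<in> U then f' x b else 0) = 0"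
    by (rule integral_directional_derivative_eq_0[OF has_derivative_zero_extension[OF U(1) K U(3) der zero(1)]
          continuous_on_zero_extension[OF U(1) K U(3) cont] U(2)])
      (use U(3) zero in auto)
  moreover have "indicator U x *\<^sub>R f' x b = (if x \<in> U then f' x b else 0)" for x
    by simp
  ultimately show ?thesis by simp
qed

lemma test_funE:
  assumes "test_fun U \<phi>"
  obtains K where "compact K" "K \<subseteq> U" "\<And>x. x \<notin> K \<Longrightarrow> \<phi> x = 0"
    "\<And>x v. x \<notin> K \<Longrightarrow> frechet_derivative \<phi> (at x) v = 0"
    "\<And>x. (\<phi> has_derivative frechet_derivative \<phi> (at x)) (at x)"
    "\<And>b. b \<in> Basis \<Longrightarrow> continuous_on UNIV (\<lambda>x. frechet_derivative \<phi> (at x) b)"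
proof -
  define K where "K = closure {x. \<phi> x \<noteq> 0}"
  have K: "compact K" "K \<subseteq> U" "closed K" using assms by (auto simp: test_fun_def K_def)
  have zero: "\<phi> x = 0" if "x \<notin> K" for x
    using that closure_subset[of "{x. \<phi> x \<noteq> 0}"] by (auto simp: K_def)
  have deriv_zero: "frechet_derivative \<phi> (at x) v = 0" if "x \<notin> K" for x v
  proof -
    have "(\<phi> has_derivative (\<lambda>_. 0)) (at x)"
      by (rule has_derivative_transform_within_open[of "\<lambda>_. 0" _ _ _ "- K"]) (use that zero K(3) in auto)
    then show ?thesis using frechet_derivative_at by metis
  qed
  have "Ck 1 \<phi>" using assms by (simp add: test_fun_def)
  then have "\<And>x. (\<phi> has_derivative frechet_derivative \<phi> (at x)) (at x)"
    and "\<And>b. b \<in> Basis \<Longrightarrow> continuous_on UNIV (\<lambda>x. frechet_derivative \<phi> (at x) b)"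
    by (auto simp: frechet_derivative_works)
  with K(1,2) zero deriv_zero show thesis by (rule that)
qed

lemma weak_partial_C1:
  fixes g :: "real^'n \<Rightarrow> real^'n"
  assumes U: "open U"
    and der: "\<And>x. x \<in> U \<Longrightarrow> (g has_derivative g' x) (at x)"
    and cont: "continuous_on U (\<lambda>x. g' x b)" and b: "b \<in> Basis"
  shows "weak_partial U b g (\<lambda>x. g' x b)"
  unfolding weak_partial_def
proof (intro allI impI)
  fix \<phi> :: "real^'n \<Rightarrow> real" assume "test_fun U \<phi>"
  let ?\<phi>' = "\<lambda>x. frechet_derivative \<phi> (at x)"
  obtain K where K: "compact K" "K \<subseteq> U" and \<phi>: "\<And>x. x \<notin> K \<Longrightarrow> \<phi> x = 0" "\<And>x v. x \<notin> K \<Longrightarrow> ?\<phi>' x v = 0"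
    "\<And>x. (\<phi> has_derivative ?\<phi>' x) (at x)" "\<And>b. b \<in> Basis \<Longrightarrow> continuous_on UNIV (\<lambda>x. ?\<phi>' x b)"
    using \<open>test_fun U \<phi>\<close> by (rule test_funE) (rule that)
  have cg: "continuous_on U g"
    using der by (meson continuous_at_imp_continuous_on has_derivative_continuous)
  have c\<phi>: "continuous_on U \<phi>"
    using \<phi>(3) by (meson continuous_at_imp_continuous_on has_derivative_continuous)
  have c\<phi>': "continuous_on U (\<lambda>x. ?\<phi>' x b)"
    using \<phi>(4)[OF b] by (rule continuous_on_subset) simp
  have int_left: "integrable lborel (\<lambda>x. indicator U x *\<^sub>R (?\<phi>' x b *\<^sub>R g x))"
    using K \<phi>(2) by (intro integrable_on_compact_support[of K] continuous_intros cg c\<phi>') auto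
  have int_right: "integrable lborel (\<lambda>x. indicator U x *\<^sub>R (\<phi> x *\<^sub>R g' x b))"
    using K \<phi>(1) by (intro integrable_on_compact_support[of K] continuous_intros cont c\<phi>) auto
  have "(LINT x:U|lebesgue. ?\<phi>' x b *\<^sub>R g x) + (LINT x:U|lebesgue. \<phi> x *\<^sub>R g' x b)
     = integral\<^sup>L lborel (\<lambda>x. indicator U x *\<^sub>R (?\<phi>' x b *\<^sub>R g x))
       + integral\<^sup>L lborel (\<lambda>x. indicator U x *\<^sub>R (\<phi> x *\<^sub>R g' x b))"
    unfolding set_lebesgue_integral_def
    by (simp only: integral_completion[OF borel_measurable_integrable[OF int_left]]
      integral_completion[OF borel_measurable_integrable[OF int_right]])
  also have "\<dots> = integral\<^sup>L lborel (\<lambda>x. indicator U x *\<^sub>R (\<phi> x *\<^sub>R g' x b + ?\<phi>' x b *\<^sub>R g x))"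
    unfolding Bochner_Integration.integral_add[OF int_left int_right, symmetric]
    by (intro Bochner_Integration.integral_cong) (auto simp: algebra_simps)
  also have "\<dots> = 0"
  proof (rule integral_directional_derivative_on_eq_0[OF U K])
    show "((\<lambda>x. \<phi> x *\<^sub>R g x) has_derivative (\<lambda>v. \<phi> x *\<^sub>R g' x v + ?\<phi>' x v *\<^sub>R g x)) (at x)" if "x \<in> U" for x
      by (rule has_derivative_scaleR[OF \<phi>(3) der[OF that]])
    show "continuous_on U (\<lambda>x. \<phi> x *\<^sub>R g' x b + ?\<phi>' x b *\<^sub>R g x)"
      by (intro continuous_intros cont cg c\<phi> c\<phi>')
  qed (use \<phi>(1,2) in auto)
  finally show "(LINT x:U|lebesgue. ?\<phi>' x b *\<^sub>R g x) = - (LINT x:U|lebesgue. \<phi> x *\<^sub>R g' x b)"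
    by (simp add: eq_neg_iff_add_eq_0)
qed

lemma in_Lp_continuous_on_cball:
  fixes g :: "real^'n \<Rightarrow> real^'n"
  assumes "continuous_on (cball x \<delta>) g"
  shows "in_Lp p (ball x \<delta>) g"
  unfolding in_Lp_def
proof
  have "set_borel_measurable borel (ball x \<delta>) g"
    unfolding set_borel_measurable_def using assms
    by (intro borel_measurable_continuous_on_indicator) (auto intro: continuous_on_subset)
  then show "set_borel_measurable lebesgue (ball x \<delta>) g"
    unfolding set_borel_measurable_def by (simp add: measurable_completion)
  have "bounded (g ` cball x \<delta>)"
    using assms by (simp add: compact_continuous_image compact_imp_bounded)
  then obtain B where B: "\<And>y. y \<in> cball x \<delta> \<Longrightarrow> norm (g y) \<le> B" unfolding bounded_iff by blast
  have "(\<integral>\<^sup>+y\<in>ball x \<delta>. ennreal (norm (g y) ^ p) \<partial>lebesgue)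
      \<le> (\<integral>\<^sup>+y. ennreal (B ^ p) * indicator (ball x \<delta>) y \<partial>lebesgue)"
    using B by (intro nn_integral_mono) (auto simp: indicator_def intro!: ennreal_leI power_mono)
  also have "\<dots> = ennreal (B ^ p) * emeasure lebesgue (ball x \<delta>)"
    by (rule nn_integral_cmult_indicator) simp
  also have "\<dots> < \<infinity>"
    using emeasure_bounded_finite[OF bounded_ball[of x \<delta>]] by (simp add: ennreal_mult_less_top)
  finally show "(\<integral>\<^sup>+y\<in>ball x \<delta>. ennreal (norm (g y) ^ p) \<partial>lebesgue) < \<infinity>" .
qed

lemma sobolev_W1_C1:
  fixes g :: "real^'n \<Rightarrow> real^'n"
  assumes "cball x \<delta> \<subseteq> V"
    and der: "\<And>y. y \<in> V \<Longrightarrow> (g has_derivative g' y) (at y)"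
    and cont: "\<And>b. continuous_on V (\<lambda>y. g' y b)"
  shows "sobolev_W1 p (ball x \<delta>) g"
proof -
  have ball: "ball x \<delta> \<subseteq> V" using assms(1) ball_subset_cball by blast
  have "continuous_on V g"
    using der by (meson continuous_at_imp_continuous_on has_derivative_continuous)
  then have "in_Lp p (ball x \<delta>) g"
    using assms(1) by (intro in_Lp_continuous_on_cball) (rule continuous_on_subset)
  moreover have "in_Lp p (ball x \<delta>) (\<lambda>y. g' y b)" for b
    using assms(1) by (intro in_Lp_continuous_on_cball continuous_on_subset[OF cont])
  moreover have "weak_partial (ball x \<delta>) b g (\<lambda>y. g' y b)" if "b \<in> Basis" for b
    using ball by (intro weak_partial_C1 der continuous_on_subset[OF cont] that) auto
  ultimately show ?thesis unfolding sobolev_W1_def by blast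
qed

lemma K_I_integrable_ball:
  fixes g :: "real^'n \<Rightarrow> real^'n"
  assumes "cball x \<delta> \<subseteq> V" "\<And>y. y \<in> V \<Longrightarrow> K_I g y = ennreal (\<kappa> y)" "continuous_on V \<kappa>"
  shows "(\<lambda>y. K_I g y * indicator (ball x \<delta>) y) \<in> borel_measurable lebesgue"
    "(\<integral>\<^sup>+y\<in>ball x \<delta>. K_I g y \<partial>lebesgue) < \<infinity>"
proof -
  have \<kappa>: "continuous_on (cball x \<delta>) \<kappa>" using assms(3,1) by (rule continuous_on_subset)
  have eq: "K_I g y * indicator (ball x \<delta>) y = ennreal (indicator (ball x \<delta>) y *\<^sub>R \<kappa> y)" for y
    using assms(2)[of y] subsetD[OF assms(1), of y] by (auto simp: indicator_def)
  have "(\<lambda>y. indicator (ball x \<delta>) y *\<^sub>R \<kappa> y) \<in> borel_measurable borel"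
    by (rule borel_measurable_continuous_on_indicator) (use \<kappa> in \<open>auto intro: continuous_on_subset\<close>)
  then have "(\<lambda>y. ennreal (indicator (ball x \<delta>) y *\<^sub>R \<kappa> y)) \<in> borel_measurable lborel" by simp
  then show "(\<lambda>y. K_I g y * indicator (ball x \<delta>) y) \<in> borel_measurable lebesgue"
    unfolding eq by (rule measurable_completion)
  have "bounded (\<kappa> ` cball x \<delta>)"
    using \<kappa> by (simp add: compact_continuous_image compact_imp_bounded)
  then obtain B where B: "\<And>y. y \<in> cball x \<delta> \<Longrightarrow> norm (\<kappa> y) \<le> B" unfolding bounded_iff by blast
  have "(\<integral>\<^sup>+y\<in>ball x \<delta>. K_I g y \<partial>lebesgue) \<le> (\<integral>\<^sup>+y. ennreal B * indicator (ball x \<delta>) y \<partial>lebesgue)"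
    unfolding eq using B
    by (intro nn_integral_mono) (auto simp: indicator_def abs_le_iff intro!: ennreal_leI)
  also have "\<dots> = ennreal B * emeasure lebesgue (ball x \<delta>)"
    by (rule nn_integral_cmult_indicator) simp
  also have "\<dots> < \<infinity>"
    using emeasure_bounded_finite[OF bounded_ball[of x \<delta>]] by (simp add: ennreal_mult_less_top)
  finally show "(\<integral>\<^sup>+y\<in>ball x \<delta>. K_I g y \<partial>lebesgue) < \<infinity>" .
qed

lemma regular_at_imp_locally_integrable:
  fixes g :: "real^'n \<Rightarrow> real^'n"
  assumes "regular_at g x" "open \<Omega>" "x \<in> \<Omega>"
  obtains \<delta> where "0 < \<delta>" "cball x \<delta> \<subseteq> \<Omega>" "sobolev_W1 p (ball x \<delta>) g"
    "(\<lambda>y. K_I g y * indicator (ball x \<delta>) y) \<in> borel_measurable lebesgue"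
    "(\<integral>\<^sup>+y\<in>ball x \<delta>. K_I g y \<partial>lebesgue) < \<infinity>"
proof -
  obtain U g' \<kappa> where U: "open U" "x \<in> U" "\<And>y. y \<in> U \<Longrightarrow> (g has_derivative g' y) (at y)"
    "\<And>y. y \<in> U \<Longrightarrow> K_I g y = ennreal (\<kappa> y)" "continuous_on U \<kappa>" "\<And>b. continuous_on U (\<lambda>y. g' y b)"
    using assms(1) by (rule regular_atE) (rule that)
  obtain \<delta> where \<delta>: "0 < \<delta>" "cball x \<delta> \<subseteq> U \<inter> \<Omega>"
    using open_contains_cball[of "U \<inter> \<Omega>"] U(1,2) assms(2,3) by blast
  then have "cball x \<delta> \<subseteq> U" by blast
  with \<delta> show thesis
    using sobolev_W1_C1[OF _ U(3,6)] K_I_integrable_ball[OF _ U(4,5)] by (intro that) auto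
qed

section \<open>The topology of the extended space\<close>

lemma sqrt_norm_ge_1: "1 \<le> sqrt (1 + (norm x)\<^sup>2)"
  by simp

lemma sqrt_norm_pos: "0 < sqrt (1 + (norm x)\<^sup>2)"
  using sqrt_norm_ge_1[of x] by linarith

lemma chordal_Some_le: "chordal (Some x) (Some y) \<le> norm (x - y)"
proof -
  have "1 \<le> sqrt (1 + (norm x)\<^sup>2) * sqrt (1 + (norm y)\<^sup>2)"
    using mult_mono[OF sqrt_norm_ge_1[of x] sqrt_norm_ge_1[of y]] by simp
  then show ?thesis
    using divide_left_mono[of 1 "sqrt (1 + (norm x)\<^sup>2) * sqrt (1 + (norm y)\<^sup>2)" "norm (x - y)"] by simp
qed

lemma chordal_Some_ge:
  assumes "e \<le> norm (x - y)" "0 < e"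
  shows "e / (sqrt (1 + (norm x)\<^sup>2) * (1 + norm x + e)) \<le> chordal (Some x) (Some y)"
proof -
  define t where "t = norm (x - y)"
  have "norm y \<le> norm x + t"
    unfolding t_def using norm_triangle_ineq4[of x "x - y"] by simp
  moreover have "sqrt (1 + (norm y)\<^sup>2) \<le> 1 + norm y"
    by (rule real_le_lsqrt) (auto simp: power2_eq_square algebra_simps)
  ultimately have y: "sqrt (1 + (norm y)\<^sup>2) \<le> 1 + norm x + t" by simp
  have pos: "0 < 1 + norm x + e" "0 < 1 + norm x + t"
    using assms norm_ge_zero[of x] unfolding t_def by linarith+
  have "e * (1 + norm x + t) \<le> t * (1 + norm x + e)"
    using assms mult_right_mono[of e t "1 + norm x"] by (simp add: t_def algebra_simps)
  then have "e / (1 + norm x + e) \<le> t / (1 + norm x + t)"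
    using pos by (simp add: field_simps)
  also have "\<dots> \<le> t / sqrt (1 + (norm y)\<^sup>2)"
    using y sqrt_norm_pos[of y] pos by (intro divide_left_mono mult_pos_pos) (auto simp: t_def)
  finally have "e / (1 + norm x + e) / sqrt (1 + (norm x)\<^sup>2)
      \<le> t / sqrt (1 + (norm y)\<^sup>2) / sqrt (1 + (norm x)\<^sup>2)"
    by (rule divide_right_mono) simp
  then show ?thesis by (simp add: t_def mult.commute)
qed

lemma chordal_lower_bound_away:
  assumes "0 < e"
  obtains r where "0 < r" "\<And>q. \<forall>y. q = Some y \<longrightarrow> e \<le> norm (x - y) \<Longrightarrow> r \<le> chordal (Some x) q"
proof
  let ?r = "e / (sqrt (1 + (norm x)\<^sup>2) * (1 + norm x + e))"
  show "0 < ?r"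
    using assms sqrt_norm_pos[of x] by (intro divide_pos_pos mult_pos_pos add_nonneg_pos) auto
  fix q assume q: "\<forall>y. q = Some y \<longrightarrow> e \<le> norm (x - y)"
  show "?r \<le> chordal (Some x) q"
  proof (cases q)
    case None
    have "?r = (e / (1 + norm x + e)) * (1 / sqrt (1 + (norm x)\<^sup>2))"
      by simp
    also have "\<dots> \<le> 1 * (1 / sqrt (1 + (norm x)\<^sup>2))"
      using assms norm_ge_zero[of x] by (intro mult_right_mono) (auto simp: divide_le_eq_1)
    finally show ?thesis using None by simp
  next
    case (Some y)
    then have "e \<le> norm (x - y)" using q by simp
    then show ?thesis using chordal_Some_ge[OF _ assms, of x y] Some by simp
  qed
qed

lemma ex_mball_Some_subset_iff:
  "(\<exists>r>0. chordal.mball (Some x) r \<subseteq> V) \<longleftrightarrow> (\<exists>e>0. \<forall>y. dist y x < e \<longrightarrow> Some y \<in> V)"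
proof
  assume "\<exists>r>0. chordal.mball (Some x) r \<subseteq> V"
  then obtain r where r: "0 < r" "chordal.mball (Some x) r \<subseteq> V" by blast
  have "Some y \<in> V" if "dist y x < r" for y
    using that chordal_Some_le[of x y] r(2) by (auto simp: subset_iff dist_norm norm_minus_commute)
  then show "\<exists>e>0. \<forall>y. dist y x < e \<longrightarrow> Some y \<in> V" using r(1) by blast
next
  assume "\<exists>e>0. \<forall>y. dist y x < e \<longrightarrow> Some y \<in> V"
  then obtain e where e: "0 < e" "\<And>y. dist y x < e \<Longrightarrow> Some y \<in> V" by blast
  obtain r where r: "0 < r" "\<And>q. \<forall>y. q = Some y \<longrightarrow> e \<le> norm (x - y) \<Longrightarrow> r \<le> chordal (Some x) q"
    using chordal_lower_bound_away[OF e(1), of x] by blast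
  have "q \<in> V" if "chordal (Some x) q < r" for q
    using that r(2)[of q] e(2) by (force simp: dist_norm norm_minus_commute not_le)
  then show "\<exists>r>0. chordal.mball (Some x) r \<subseteq> V" using r(1) by (auto intro!: exI[of _ r])
qed

lemma ex_mball_None_subset_iff:
  "(\<exists>r>0. chordal.mball None r \<subseteq> V) \<longleftrightarrow> None \<in> V \<and> (\<forall>\<^sub>F x in at_infinity. Some x \<in> V)"
proof
  assume "\<exists>r>0. chordal.mball None r \<subseteq> V"
  then obtain r where r: "0 < r" "chordal.mball None r \<subseteq> V" by blast
  have "Some x \<in> V" if "1 / r \<le> norm x" for x
  proof -
    have "norm x < sqrt (1 + (norm x)\<^sup>2)" by (rule real_less_rsqrt) simp
    then have "1 / r < sqrt (1 + (norm x)\<^sup>2)" using that by simp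
    then have "1 / sqrt (1 + (norm x)\<^sup>2) < r"
      using r(1) sqrt_norm_pos[of x] by (simp only: pos_divide_less_eq mult.commute)
    then show ?thesis using r(2) by (auto simp: subset_iff)
  qed
  moreover have "None \<in> V" using r by (auto simp: subset_iff)
  ultimately show "None \<in> V \<and> (\<forall>\<^sub>F x in at_infinity. Some x \<in> V)"
    unfolding eventually_at_infinity by blast
next
  assume V: "None \<in> V \<and> (\<forall>\<^sub>F x in at_infinity. Some x \<in> V)"
  then obtain b where b: "\<And>x. b \<le> norm x \<Longrightarrow> Some x \<in> V"
    unfolding eventually_at_infinity by blast
  define r where "r = 1 / sqrt (1 + (max 0 b)\<^sup>2)"
  have "q \<in> V" if "chordal None q < r" for q
  proof (cases q)
    case (Some x)
    have "1 / sqrt (1 + (norm x)\<^sup>2) < 1 / sqrt (1 + (max 0 b)\<^sup>2)" using that Some by (simp add: r_def)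
    then have "sqrt (1 + (max 0 b)\<^sup>2) < sqrt (1 + (norm x)\<^sup>2)"
      using frac_le[of 1 1 "sqrt (1 + (norm x)\<^sup>2)" "sqrt (1 + (max 0 b)\<^sup>2)"] sqrt_norm_pos[of x] by linarith
    then have "(max 0 b)\<^sup>2 < (norm x)\<^sup>2" by simp
    then have "max 0 b < norm x" by (rule power2_less_imp_less) simp
    then show ?thesis using b Some by simp
  qed (use V in simp)
  moreover have "0 < r" by (simp add: r_def add_pos_nonneg)
  ultimately show "\<exists>r>0. chordal.mball None r \<subseteq> V" by (auto intro!: exI[of _ r])
qed

lemma openin_xtop_iff:
  "openin xtop V \<longleftrightarrow> open {x. Some x \<in> V} \<and> (None \<in> V \<longrightarrow> (\<forall>\<^sub>F x in at_infinity. Some x \<in> V))"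
proof -
  have "openin xtop V \<longleftrightarrow> (\<forall>p\<in>V. \<exists>r>0. chordal.mball p r \<subseteq> V)"
    by (auto simp: chordal.openin_mtopology)
  also have "\<dots> \<longleftrightarrow> (\<forall>x. Some x \<in> V \<longrightarrow> (\<exists>r>0. chordal.mball (Some x) r \<subseteq> V))
      \<and> (None \<in> V \<longrightarrow> (\<exists>r>0. chordal.mball None r \<subseteq> V))"
    by (metis option.exhaust)
  finally show ?thesis
    unfolding ex_mball_Some_subset_iff ex_mball_None_subset_iff open_dist by auto
qed

lemma limitin_xtop_Some:
  assumes "x \<longlonglongrightarrow> x0"
  shows "limitin xtop (\<lambda>m. Some (x m)) (Some x0) sequentially"
  unfolding chordal.limitin_metric
proof (intro conjI allI impI)
  fix \<gamma> :: real assume "0 < \<gamma>"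
  with assms have "\<forall>\<^sub>F m in sequentially. dist (x m) x0 < \<gamma>" by (rule tendstoD)
  then show "\<forall>\<^sub>F m in sequentially. Some (x m) \<in> UNIV \<and> chordal (Some (x m)) (Some x0) < \<gamma>"
    using chordal_Some_le[of "x m" x0 for m]
    by (auto simp: dist_norm elim!: eventually_mono intro: le_less_trans)
qed simp

lemma Some_in_map_option_image:
  "Some y \<in> map_option g ` V \<longleftrightarrow> (\<exists>x. Some x \<in> V \<and> g x = y)"
  unfolding image_iff eq_commute[of "Some y"] map_option_eq_Some by blast

lemma continuous_map_map_option:
  fixes D :: "(real^'n) option set" and g :: "real^'n \<Rightarrow> real^'m"
  assumes D: "openin xtop D" and cont: "continuous_on {x. Some x \<in> D} g"
    and inf: "None \<in> D \<Longrightarrow> filterlim g at_infinity at_infinity"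
  shows "continuous_map (subtopology xtop D) xtop (map_option g)"
  unfolding continuous_map_def
proof (intro conjI allI impI)
  fix W :: "(real^'m) option set" assume W: "openin xtop W"
  let ?V = "{p \<in> topspace (subtopology xtop D). map_option g p \<in> W}"
  have "{x. Some x \<in> ?V} = {x. Some x \<in> D} \<inter> g -` {y. Some y \<in> W}" by auto
  then have "open {x. Some x \<in> ?V}"
    using cont D W by (simp only:) (intro continuous_open_preimage, auto simp: openin_xtop_iff)
  moreover have "\<forall>\<^sub>F x in at_infinity. Some x \<in> ?V" if "None \<in> ?V"
  proof -
    from that have None: "None \<in> D" "None \<in> W" by auto
    then have "\<forall>\<^sub>F x in at_infinity. Some (g x) \<in> W"
      using W inf by (auto simp: openin_xtop_iff filterlim_iff)
    moreover have "\<forall>\<^sub>F x in at_infinity. Some x \<in> D"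
      using D None by (simp add: openin_xtop_iff)
    ultimately show ?thesis by eventually_elim simp
  qed
  ultimately have "openin xtop ?V" unfolding openin_xtop_iff by blast
  then show "openin (subtopology xtop D) ?V"
    using D by (simp add: openin_open_subtopology)
qed auto

lemma open_map_map_option:
  fixes D :: "(real^'n) option set" and g :: "real^'n \<Rightarrow> real^'n"
  assumes D: "openin xtop D"
    and cont: "continuous_on {x. Some x \<in> D} g" and inj: "inj_on g {x. Some x \<in> D}"
    and inf: "None \<in> D \<Longrightarrow> \<forall>\<^sub>F x in at_infinity. g x = x"
  shows "open_map (subtopology xtop D) xtop (map_option g)"
  unfolding open_map_def
proof (intro allI impI)
  fix V assume "openin (subtopology xtop D) V"
  then have V: "openin xtop V" "V \<subseteq> D" using D by (auto simp: openin_open_subtopology)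
  have "{y. Some y \<in> map_option g ` V} = g ` {x. Some x \<in> V}"
    unfolding Some_in_map_option_image by auto
  moreover have "open (g ` {x. Some x \<in> V})"
    using V cont inj by (intro invariance_of_domain)
      (auto simp: openin_xtop_iff elim: continuous_on_subset inj_on_subset)
  moreover have "\<forall>\<^sub>F y in at_infinity. Some y \<in> map_option g ` V" if "None \<in> map_option g ` V"
  proof -
    from that have "None \<in> V" by auto
    then have "\<forall>\<^sub>F y in at_infinity. g y = y" "\<forall>\<^sub>F y in at_infinity. Some y \<in> V"
      using inf V by (auto simp: openin_xtop_iff)
    then show ?thesis
      by eventually_elim (metis Some_in_map_option_image)
  qed
  ultimately show "openin xtop (map_option g ` V)"
    unfolding openin_xtop_iff by simp
qed

lemma embedding_map_map_option:
  fixes D :: "(real^'n) option set" and g :: "real^'n \<Rightarrow> real^'n"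
  assumes "openin xtop D"
    and "continuous_on {x. Some x \<in> D} g" and inj: "inj_on g {x. Some x \<in> D}"
    and inf: "None \<in> D \<Longrightarrow> \<forall>\<^sub>F x in at_infinity. g x = x"
  shows "embedding_map (subtopology xtop D) xtop (map_option g)"
proof (rule injective_open_imp_embedding_map)
  have "filterlim g at_infinity at_infinity" if "None \<in> D"
    using filterlim_cong[OF refl refl inf[OF that]] by (simp add: filterlim_ident)
  then show "continuous_map (subtopology xtop D) xtop (map_option g)"
    using assms(1,2) by (intro continuous_map_map_option)
  show "open_map (subtopology xtop D) xtop (map_option g)"
    by (rule open_map_map_option[OF assms])
  show "inj_on (map_option g) (topspace (subtopology xtop D))"
  proof (rule inj_onI)
    fix p q assume "p \<in> topspace (subtopology xtop D)" "q \<in> topspace (subtopology xtop D)"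
      "map_option g p = map_option g q"
    then show "p = q" using inj by (cases p; cases q) (auto dest: inj_onD)
  qed
qed

section \<open>Membership in the classes\<close>

lemma local_rep_map_option_Some [simp]: "local_rep (map_option g) (Some x) = g"
  by (simp add: fun_eq_iff local_rep_def xcoord_def xchart_def)

lemma xK_I_map_option_Some [simp]: "xK_I (map_option g) (Some x) = K_I g x"
  by (simp add: xK_I_def xcoord_def)

lemma coord_nbhd_subset:
  assumes "coord_nbhd D f p \<Omega>" "open U" "xcoord p p \<in> U" "U \<subseteq> \<Omega>"
  shows "coord_nbhd D f p U"
  using assms by (auto simp: coord_nbhd_def)

lemma coord_nbhd_map_option_Some:
  assumes "openin xtop D" "Some x \<in> D"
  shows "coord_nbhd D (map_option g) (Some x) {y. Some y \<in> D}"
  using assms by (auto simp: coord_nbhd_def xcoord_def xchart_def[abs_def] openin_xtop_iff)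

lemma coord_nbhd_map_option_None:
  fixes D :: "(real^'n) option set" and g :: "real^'n \<Rightarrow> real^'n"
  assumes D: "openin xtop D" "None \<in> D" and inf: "\<forall>\<^sub>F x in at_infinity. g x = x"
  obtains \<Omega> where "coord_nbhd D (map_option g) None \<Omega>"
    "\<And>x. x \<in> \<Omega> \<Longrightarrow> local_rep (map_option g) None x = x"
proof -
  have "\<forall>\<^sub>F x in at_infinity. g x = x \<and> Some x \<in> D"
    using D inf by (simp add: openin_xtop_iff eventually_conj_iff)
  then obtain R where R: "0 < R" "\<And>x. R \<le> norm x \<Longrightarrow> g x = x \<and> Some x \<in> D"
    by (auto simp: eventually_at_infinity_pos)
  define \<Omega> where "\<Omega> = ball (0::real^'n) (1 / R)"
  have chart: "map_option g (xchart None x) = xchart None x" "xchart None x \<in> D" if "x \<in> \<Omega>" for x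
  proof -
    have "g ((1 / (norm x)\<^sup>2) *\<^sub>R x) = (1 / (norm x)\<^sup>2) *\<^sub>R x \<and> Some ((1 / (norm x)\<^sup>2) *\<^sub>R x) \<in> D"
      if "x \<noteq> 0"
    proof (rule R(2))
      have "R \<le> 1 / norm x"
        using \<open>x \<in> \<Omega>\<close> R(1) that by (simp add: \<Omega>_def field_simps)
      then show "R \<le> norm ((1 / (norm x)\<^sup>2) *\<^sub>R x)"
        using that by (simp add: power2_eq_square)
    qed
    then show "map_option g (xchart None x) = xchart None x" "xchart None x \<in> D"
      using D(2) by (auto simp: xchart_def)
  qed
  have "coord_nbhd D (map_option g) None \<Omega>"
    unfolding coord_nbhd_def using R(1) chart by (auto simp: \<Omega>_def xcoord_def)
  moreover have "local_rep (map_option g) None x = x" if "x \<in> \<Omega>" for x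
    unfolding local_rep_def chart(1)[OF that] by (simp add: xcoord_def xchart_def power2_eq_square)
  ultimately show thesis by (rule that)
qed

definition tame_on :: "(real^'n) option set \<Rightarrow> (real^'n \<Rightarrow> real^'n) \<Rightarrow> bool" where
  "tame_on D g \<longleftrightarrow> inj_on g {x. Some x \<in> D} \<and> (\<forall>x. Some x \<in> D \<longrightarrow> regular_at g x) \<and>
     (None \<in> D \<longrightarrow> (\<forall>\<^sub>F x in at_infinity. g x = x))"

lemma tame_on_local_rep_regular:
  assumes D: "openin xtop D" and g: "tame_on D g" and "p \<in> D"
  obtains \<Omega> where "coord_nbhd D (map_option g) p \<Omega>" "regular_at (local_rep (map_option g) p) (xcoord p p)"
proof (cases p)
  case (Some x)
  then show thesis
    using coord_nbhd_map_option_Some[OF D, of x g] g assms(3) that by (simp add: tame_on_def xcoord_def)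
next
  case None
  then obtain \<Omega> where \<Omega>: "coord_nbhd D (map_option g) None \<Omega>"
    "\<And>x. x \<in> \<Omega> \<Longrightarrow> local_rep (map_option g) None x = x"
    using coord_nbhd_map_option_None[OF D] g assms(3) by (auto simp: tame_on_def)
  then have "open \<Omega>" "xcoord None None \<in> \<Omega>" by (auto simp: coord_nbhd_def)
  then have "regular_at (local_rep (map_option g) None) (xcoord None None)"
    by (rule regular_at_cong_open[OF _ _ _ regular_at_scaling[of 1 0]]) (use \<Omega>(2) in simp_all)
  then show thesis using \<Omega>(1) None that by simp
qed

lemma tame_on_locally_integrable:
  assumes "openin xtop D" "tame_on D g" "p \<in> D"
  obtains U where "coord_nbhd D (map_option g) p U" "sobolev_W1 k U (local_rep (map_option g) p)"
    "(\<lambda>x. K_I (local_rep (map_option g) p) x * indicator U x) \<in> borel_measurable lebesgue"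
    "(\<integral>\<^sup>+x\<in>U. K_I (local_rep (map_option g) p) x \<partial>lebesgue) < \<infinity>"
proof -
  obtain \<Omega> where \<Omega>: "coord_nbhd D (map_option g) p \<Omega>"
    and reg: "regular_at (local_rep (map_option g) p) (xcoord p p)"
    using assms by (rule tame_on_local_rep_regular)
  then obtain \<delta> where \<delta>: "0 < \<delta>" "cball (xcoord p p) \<delta> \<subseteq> \<Omega>"
    "sobolev_W1 k (ball (xcoord p p) \<delta>) (local_rep (map_option g) p)"
    "(\<lambda>x. K_I (local_rep (map_option g) p) x * indicator (ball (xcoord p p) \<delta>) x) \<in> borel_measurable lebesgue"
    "(\<integral>\<^sup>+x\<in>ball (xcoord p p) \<delta>. K_I (local_rep (map_option g) p) x \<partial>lebesgue) < \<infinity>"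
    using regular_at_imp_locally_integrable[OF reg, of \<Omega>] by (auto simp: coord_nbhd_def)
  have "coord_nbhd D (map_option g) p (ball (xcoord p p) \<delta>)"
    using \<delta>(1,2) ball_subset_cball by (intro coord_nbhd_subset[OF \<Omega>]) auto
  then show thesis using \<delta>(3-5) by (rule that)
qed

lemma map_option_in_S_class:
  fixes D :: "(real^'n) option set" and g :: "real^'n \<Rightarrow> real^'n"
  assumes D: "openin xtop D" and g: "tame_on D g"
    and q: "q1 \<notin> map_option g ` D" "q2 \<notin> map_option g ` D" "\<Delta> \<le> chordal q1 q2"
    and M: "(\<integral>\<^sup>+x\<in>{x. Some x \<in> D}. \<Phi> (K_I g x) * ennreal (1 / (1 + (norm x)\<^sup>2) ^ CARD('n)) \<partial>lebesgue)
      \<le> ennreal M"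
  shows "map_option g \<in> S_class D \<Phi> M \<Delta>"
proof -
  have "continuous_on {x. Some x \<in> D} g"
    using g by (intro continuous_at_imp_continuous_on ballI regular_at_isCont) (simp add: tame_on_def)
  then have "embedding_map (subtopology xtop D) xtop (map_option g)"
    using g by (intro embedding_map_map_option[OF D]) (auto simp: tame_on_def)
  moreover have "W1n_loc D (map_option g)" "K_I_loc_integrable D (map_option g)"
    unfolding W1n_loc_def K_I_loc_integrable_def
    using tame_on_locally_integrable[OF D g] by blast+
  moreover have "ennreal \<Delta> \<le> chordal_diam (UNIV - map_option g ` D)"
  proof -
    have "ennreal \<Delta> \<le> ennreal (chordal q1 q2)" using q(3) by (rule ennreal_leI)
    also have "\<dots> \<le> chordal_diam (UNIV - map_option g ` D)"
      unfolding chordal_diam_def using q(1,2)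
      by (intro SUP_upper2[of q1] SUP_upper2[of q2]) auto
    finally show ?thesis .
  qed
  ultimately show ?thesis using M by (simp add: S_class_def)
qed

section \<open>Equicontinuity and normality along sequences\<close>

lemma equicontinuous_fam_sequentially:
  assumes equi: "equicontinuous_fam D F" and f: "\<And>m. f m \<in> F"
    and x: "limitin (subtopology xtop D) x x0 sequentially"
  shows "(\<lambda>m. chordal (f m (x m)) (f m x0)) \<longlonglongrightarrow> 0"
proof (rule order_tendstoI)
  fix \<epsilon> :: real assume "0 < \<epsilon>"
  have "x0 \<in> D" using x by (simp add: limitin_subtopology)
  then obtain U where U: "openin (subtopology xtop D) U" "x0 \<in> U"
      "\<And>y h. y \<in> U \<Longrightarrow> h \<in> F \<Longrightarrow> chordal (h y) (h x0) < \<epsilon>"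
    using equi \<open>0 < \<epsilon>\<close> unfolding equicontinuous_fam_def by meson
  then have "\<forall>\<^sub>F m in sequentially. x m \<in> U" using x by (auto simp: limitin_def)
  then show "\<forall>\<^sub>F m in sequentially. chordal (f m (x m)) (f m x0) < \<epsilon>"
    by eventually_elim (use U(3) f in blast)
next
  fix a :: real assume "a < 0"
  then show "\<forall>\<^sub>F m in sequentially. a < chordal (f m (x m)) (f m x0)"
    by (intro always_eventually allI less_le_trans[OF _ chordal.nonneg]) simp
qed

lemma not_equicontinuous_famE:
  assumes "\<not> equicontinuous_fam D F"
  obtains x0 x f \<epsilon> where "limitin (subtopology xtop D) x x0 sequentially" "\<And>m::nat. f m \<in> F" "\<And>m. x m \<in> D"
    "0 < \<epsilon>" "\<And>m. \<epsilon> \<le> chordal (f m (x m)) (f m x0)"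
proof -
  obtain x0 \<epsilon> where x0: "x0 \<in> D" and "0 < \<epsilon>"
    and bad: "\<And>U. openin (subtopology xtop D) U \<Longrightarrow> x0 \<in> U \<Longrightarrow> \<exists>x\<in>U. \<exists>f\<in>F. \<epsilon> \<le> chordal (f x) (f x0)"
    using assms unfolding equicontinuous_fam_def by (meson not_less)
  have "\<exists>x f. x \<in> D \<and> f \<in> F \<and> chordal x0 x < inverse (real (Suc m)) \<and> \<epsilon> \<le> chordal (f x) (f x0)" for m
  proof -
    have "openin (subtopology xtop D) (D \<inter> chordal.mball x0 (inverse (real (Suc m))))"
      by (simp add: openin_subtopology_Int2)
    then show ?thesis using bad x0 by fastforce
  qed
  then obtain x f where xf: "\<And>m. x m \<in> D" "\<And>m. f m \<in> F" "\<And>m. chordal x0 (x m) < inverse (real (Suc m))"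
    "\<And>m. \<epsilon> \<le> chordal (f m (x m)) (f m x0)" by metis
  have "limitin xtop x x0 sequentially"
    unfolding chordal.limitin_metric
  proof (intro conjI allI impI)
    fix \<gamma> :: real assume "0 < \<gamma>"
    with LIMSEQ_inverse_real_of_nat have "\<forall>\<^sub>F m in sequentially. inverse (real (Suc m)) < \<gamma>"
      by (rule order_tendstoD)
    then show "\<forall>\<^sub>F m in sequentially. x m \<in> UNIV \<and> chordal (x m) x0 < \<gamma>"
      by eventually_elim (metis UNIV_I chordal.commute less_trans xf(3))
  qed simp
  then have "limitin (subtopology xtop D) x x0 sequentially"
    using xf(1) x0 by (simp add: limitin_subtopology)
  then show thesis using xf(2,1) \<open>0 < \<epsilon>\<close> xf(4) by (rule that)
qed

lemma normal_fam_imp_equicontinuous_fam: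
  assumes "normal_fam D F"
  shows "equicontinuous_fam D F"
proof (rule ccontr)
  assume "\<not> equicontinuous_fam D F"
  then obtain x0 x f \<epsilon> where lim: "limitin (subtopology xtop D) x x0 sequentially"
    and f: "\<And>m::nat. f m \<in> F" and x: "\<And>m. x m \<in> D" and \<epsilon>: "0 < \<epsilon>" "\<And>m. \<epsilon> \<le> chordal (f m (x m)) (f m x0)"
    by (rule not_equicontinuous_famE) (rule that)
  have "range f \<subseteq> F" using f by auto
  with assms have "\<exists>(r :: nat \<Rightarrow> nat) g. strict_mono r \<and> continuous_map (subtopology xtop D) xtop g \<and>
      (\<forall>C. C \<subseteq> D \<and> compactin xtop C \<longrightarrow> (\<forall>\<gamma>>0. \<exists>N. \<forall>k\<ge>N. \<forall>y\<in>C. chordal (f (r k) y) (g y) < \<gamma>))"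
    unfolding normal_fam_def by (elim allE[of _ f] impE)
  then obtain r :: "nat \<Rightarrow> nat" and g where r: "strict_mono r"
    and g: "continuous_map (subtopology xtop D) xtop g"
    and unif: "\<forall>C. C \<subseteq> D \<and> compactin xtop C \<longrightarrow>
      (\<forall>\<gamma>>0. \<exists>N. \<forall>k\<ge>N. \<forall>y\<in>C. chordal (f (r k) y) (g y) < \<gamma>)"
    by (elim exE conjE)
  let ?C = "insert x0 (range x)"
  have xtop_lim: "limitin xtop x x0 sequentially" and x0: "x0 \<in> D"
    using lim by (auto simp: limitin_subtopology)
  have "compactin xtop ?C" by (rule compactin_sequence_with_limit[OF xtop_lim]) auto
  moreover have "?C \<subseteq> D" using x x0 by auto
  ultimately have "\<forall>\<gamma>>0. \<exists>N. \<forall>k\<ge>N. \<forall>y\<in>?C. chordal (f (r k) y) (g y) < \<gamma>"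
    using unif[rule_format, of ?C] by simp
  moreover have third: "0 < \<epsilon> / 3" using \<epsilon>(1) by simp
  ultimately obtain N where N: "\<forall>k\<ge>N. \<forall>y\<in>?C. chordal (f (r k) y) (g y) < \<epsilon> / 3"
    by blast
  have "limitin xtop (g \<circ> x) (g x0) sequentially" by (rule continuous_map_limit[OF g lim])
  then have "\<forall>\<^sub>F m in sequentially. (g \<circ> x) m \<in> UNIV \<and> chordal ((g \<circ> x) m) (g x0) < \<epsilon> / 3"
    using third unfolding chordal.limitin_metric by blast
  then obtain N' where N': "\<And>m. N' \<le> m \<Longrightarrow> chordal (g (x m)) (g x0) < \<epsilon> / 3"
    unfolding eventually_sequentially by auto
  define k where "k = max N N'"
  let ?m = "r k"
  have "N' \<le> ?m" using seq_suble[OF r, of k] by (simp add: k_def)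
  have "chordal (f ?m (x ?m)) (f ?m x0)
      \<le> chordal (f ?m (x ?m)) (g (x ?m)) + (chordal (g (x ?m)) (g x0) + chordal (g x0) (f ?m x0))"
    using chordal.triangle[of "f ?m (x ?m)" "g (x ?m)" "f ?m x0"]
      chordal.triangle[of "g (x ?m)" "g x0" "f ?m x0"] by simp
  moreover have "chordal (f ?m (x ?m)) (g (x ?m)) < \<epsilon> / 3" "chordal (g x0) (f ?m x0) < \<epsilon> / 3"
    using N[rule_format, of k] by (auto simp: k_def chordal.commute)
  ultimately show False using N'[OF \<open>N' \<le> ?m\<close>] \<epsilon>(2)[of ?m] by linarith
qed

section \<open>Cavities and concentration\<close>

lemma eventually_norm_diff_ge_at_infinity:
  fixes c :: "'a::real_normed_vector"
  shows "\<forall>\<^sub>F x in at_infinity. r \<le> norm (x - c)"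
  unfolding eventually_at_infinity
proof (intro exI allI impI)
  show "r \<le> norm (x - c)" if "r + norm c \<le> norm x" for x
    using that norm_triangle_ineq2[of x c] by simp
qed

lemma radial_map_ident_outside:
  assumes "\<And>s. ln r \<le> s \<Longrightarrow> P s = s" "0 < r" "r \<le> norm (x - c)"
  shows "radial_map c P x = x"
  using assms by (intro radial_map_ident assms(1) ln_mono) auto

lemma norm_radial_map_less:
  assumes "strict_mono P" "P (ln r) = ln r" "0 < r" "norm (x - c) < r"
  shows "norm (radial_map c P x - c) < r"
proof (cases "x = c")
  case False
  then have "ln (norm (x - c)) < ln r" using assms(4) by (intro ln_strict_mono) auto
  then have "exp (P (ln (norm (x - c)))) < exp (P (ln r))"
    using assms(1) by (simp add: strict_mono_less)
  then show ?thesis using False assms(2,3) by (simp add: norm_radial_map)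
qed (use assms(3) in simp)

lemma tame_on_radial_map:
  fixes c :: "real^'n"
  assumes P: "radial_profile P v" and ident: "\<And>s. ln r \<le> s \<Longrightarrow> P s = s" and "0 < r"
  shows "tame_on (- {Some c}) (radial_map c P)"
proof -
  have "\<forall>\<^sub>F x in at_infinity. radial_map c P x = x"
    using eventually_norm_diff_ge_at_infinity
    by (rule eventually_mono) (rule radial_map_ident_outside[OF ident assms(3)])
  moreover have "inj (radial_map c P)"
    by (intro inj_radial_map radial_profile_strict_mono[OF P])
  ultimately show ?thesis
    using regular_at_radial_map[OF P] by (auto simp: tame_on_def intro: inj_on_subset)
qed

lemma radial_map_omits_ball:
  assumes "\<And>s. ln \<eta> \<le> P s" "0 < \<eta>" "norm (y - c) < \<eta>"
  shows "Some y \<notin> map_option (radial_map c P) ` (- {Some c})"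
proof
  assume "Some y \<in> map_option (radial_map c P) ` (- {Some c})"
  then obtain x where x: "x \<noteq> c" "y = radial_map c P x" by (auto simp: Some_in_map_option_image)
  have "\<eta> = exp (ln \<eta>)" using assms(2) by simp
  also have "\<dots> \<le> norm (y - c)" unfolding x(2) norm_radial_map[OF x(1)] using assms(1) by simp
  finally show False using assms(3) by simp
qed

definition cavity_map ::
  "(ennreal \<Rightarrow> ennreal) \<Rightarrow> (real^'n) option \<Rightarrow> real^'n \<Rightarrow> real \<Rightarrow> (real^'n \<Rightarrow> real^'n) \<Rightarrow> bool" where
  "cavity_map \<Phi> p x0 \<epsilon> G \<longleftrightarrow> 0 < \<epsilon> \<and> (\<forall>y. p = Some y \<longrightarrow> \<epsilon> \<le> norm (y - x0)) \<and>
     tame_on (- {p}) G \<and> (\<forall>x. norm (x - x0) < 2 * \<epsilon> \<longrightarrow> G x = x) \<and>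
     (\<exists>q1 q2. q1 \<noteq> q2 \<and> {q1, q2} \<inter> map_option G ` (- {p}) = {}) \<and>
     (\<exists>B c. 0 \<le> B \<and> (\<forall>x. Some x \<noteq> p \<longrightarrow> x \<noteq> c \<longrightarrow> \<Phi> (K_I G x) \<le> ennreal (B * pole_weight c x)))"

lemma cavity_map_finite:
  fixes p x0 :: "real^'n"
  assumes profile: "cavitating_profile \<Phi> (CARD('n) - 1) P v L C" and "p \<noteq> x0"
  defines "\<epsilon> \<equiv> norm (p - x0) / 4"
  shows "cavity_map \<Phi> (Some p) x0 \<epsilon> (radial_map p (\<lambda>s. ln \<epsilon> + P (s - ln \<epsilon>)))"
    (is "cavity_map _ _ _ _ (radial_map p ?P)")
proof -
  note P = cavitating_profileD(1-3)[OF profile] and bound = cavitating_profileD(4)[OF profile]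
  let ?G = "radial_map p ?P"
  have \<epsilon>: "0 < \<epsilon>" using assms(2) by (simp add: \<epsilon>_def)
  have shifted: "radial_profile ?P (\<lambda>s. v (s - ln \<epsilon>))"
    using P(1) by (rule radial_profile_shift)
  have ident: "?P s = s" if "ln \<epsilon> \<le> s" for s using that by (simp add: P(2))
  have near: "?G x = x" if "norm (x - x0) < 2 * \<epsilon>" for x
  proof (rule radial_map_ident_outside[OF ident \<epsilon>])
    have "norm (p - x0) \<le> norm (x - x0) + norm (x - p)"
      using norm_triangle_ineq4[of "x - x0" "x - p"] by simp
    then show "\<epsilon> \<le> norm (x - p)" using that \<epsilon> unfolding \<epsilon>_def by linarith
  qed
  define \<eta> where "\<eta> = \<epsilon> * exp (- L)"
  have \<eta>: "0 < \<eta>" using \<epsilon> by (simp add: \<eta>_def)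
  have "ln \<eta> \<le> ?P s" for s
    using \<epsilon> P(3)[of "s - ln \<epsilon>"] by (simp add: \<eta>_def ln_mult)
  note hole = radial_map_omits_ball[of \<eta> ?P, OF this \<eta>]
  obtain e :: "real^'n" where e: "norm e = 1" using vector_choose_size zero_le_one by blast
  have "Some p \<noteq> Some (p + (\<eta> / 2) *\<^sub>R e)" using e \<eta> by auto
  moreover have "{Some p, Some (p + (\<eta> / 2) *\<^sub>R e)} \<inter> map_option ?G ` (- {Some p}) = {}"
    using hole[of p] hole[of "p + (\<eta> / 2) *\<^sub>R e"] e \<eta> by simp
  ultimately have omitted: "\<exists>q1 q2. q1 \<noteq> q2 \<and> {q1, q2} \<inter> map_option ?G ` (- {Some p}) = {}"
    by (intro exI conjI)
  have "dilatation_bound \<Phi> (CARD('n) - 1) (\<lambda>s. v (s - ln \<epsilon>)) (C * exp \<bar>ln \<epsilon>\<bar>)"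
    using bound by (rule dilatation_bound_reparam) simp
  then have "\<Phi> (K_I ?G x) \<le> ennreal (C * exp \<bar>ln \<epsilon>\<bar> * pole_weight p x)" if "x \<noteq> p" for x
    using Phi_K_I_radial_map_le[OF shifted] that by blast
  then show ?thesis
    unfolding cavity_map_def using \<epsilon> tame_on_radial_map[OF shifted ident \<epsilon>] near omitted bound
    by (auto simp: \<epsilon>_def dilatation_bound_def intro!: exI[of _ "C * exp \<bar>ln \<epsilon>\<bar>"] exI[of _ p])
qed

lemma cavity_map_infinite:
  fixes x0 :: "real^'n"
  assumes profile: "cavitating_profile \<Phi> (CARD('n) - 1) P v L C"
  shows "cavity_map \<Phi> None x0 1 (radial_map x0 (\<lambda>s. ln 2 - P (ln 2 - s)))"
    (is "cavity_map _ _ _ _ (radial_map x0 ?P)")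
proof -
  note P = cavitating_profileD(1-3)[OF profile] and bound = cavitating_profileD(4)[OF profile]
  let ?G = "radial_map x0 ?P"
  have reflected: "radial_profile ?P (\<lambda>s. v (ln 2 - s))"
    using P(1) by (rule radial_profile_reflect)
  have ident: "?P s = s + 0" if "s < ln 2" for s
    using that P(2)[of "ln 2 - s"] by simp
  have near: "?G x = x" if "norm (x - x0) < 2" for x
    using radial_map_eq_scaling[OF ident that] by simp
  have "inj ?G" by (intro inj_radial_map radial_profile_strict_mono[OF reflected])
  moreover have "regular_at ?G x" for x
    by (rule regular_at_radial_map_everywhere[OF reflected _ ident]) simp_all
  ultimately have tame: "tame_on (- {None}) ?G"
    by (auto simp: tame_on_def intro: inj_on_subset)
  have bounded: "norm (?G x - x0) \<le> 2 * exp L" for x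
  proof (cases "x = x0")
    case False
    have "norm (?G x - x0) \<le> exp (ln 2 + L)"
      using norm_radial_map[OF False, of ?P] P(3)[of "ln 2 - ln (norm (x - x0))"] by simp
    then show ?thesis by (simp add: exp_add)
  qed simp
  obtain e :: "real^'n" where e: "norm e = 1" using vector_choose_size zero_le_one by blast
  define q where "q = x0 + (2 * exp L + 1) *\<^sub>R e"
  have "norm (q - x0) = 2 * exp L + 1" using e by (simp add: q_def)
  then have "?G x \<noteq> q" for x
    using bounded[of x] by auto
  then have "{None, Some q} \<inter> map_option ?G ` (- {None}) = {}"
    by (auto simp: Some_in_map_option_image)
  moreover have "None \<noteq> Some q" by simp
  ultimately have omitted: "\<exists>q1 q2. q1 \<noteq> q2 \<and> {q1, q2} \<inter> map_option ?G ` (- {None}) = {}"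
    by (intro exI conjI)
  have "dilatation_bound \<Phi> (CARD('n) - 1) (\<lambda>s. v (ln 2 - s)) (C * exp \<bar>ln 2\<bar>)"
    using bound by (rule dilatation_bound_reparam) (rule abs_triangle_ineq4)
  then have "\<Phi> (K_I ?G x) \<le> ennreal (C * exp \<bar>ln 2\<bar> * pole_weight x0 x)" if "x \<noteq> x0" for x
    using Phi_K_I_radial_map_le[OF reflected] that by blast
  then show ?thesis
    unfolding cavity_map_def using tame near omitted bound
    by (auto simp: dilatation_bound_def intro!: exI[of _ "C * exp \<bar>ln 2\<bar>"] exI[of _ x0])
qed

definition concentrating_map ::
  "(ennreal \<Rightarrow> ennreal) \<Rightarrow> real^'n \<Rightarrow> real \<Rightarrow> real \<Rightarrow> (real^'n \<Rightarrow> real^'n) \<Rightarrow> bool" where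
  "concentrating_map \<Phi> x0 \<epsilon> B F \<longleftrightarrow> tame_on UNIV F \<and> F x0 = x0 \<and>
     (\<forall>y. \<epsilon> \<le> norm (y - x0) \<longrightarrow> F y = y) \<and> (\<forall>y. norm (y - x0) < 2 * \<epsilon> \<longrightarrow> norm (F y - x0) < 2 * \<epsilon>) \<and>
     (\<forall>y. y \<noteq> x0 \<longrightarrow> \<Phi> (K_I F y) \<le> ennreal (B * pole_weight x0 y))"

lemma exists_concentrating_map:
  fixes x0 :: "real^'n"
  assumes mono: "mono \<Phi>" and profile: "cavitating_profile \<Phi> (CARD('n) - 1) P v L C"
    and \<epsilon>: "0 < \<epsilon>" and m: "0 \<le> m"
  obtains F where "concentrating_map \<Phi> x0 \<epsilon> (C * exp \<bar>ln \<epsilon>\<bar>) F"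
    "\<And>y. norm (y - x0) = \<epsilon> * exp (- m) \<Longrightarrow> \<epsilon> * exp (- L) \<le> norm (F y - x0)"
proof -
  note P = cavitating_profileD(1-3)[OF profile] and bound = cavitating_profileD(4)[OF profile]
  obtain Q u q where Q: "radial_profile Q u" "\<And>s. v s \<le> u s"
    "\<And>s. - m \<le> s \<Longrightarrow> Q s = P s" "\<And>s. s \<le> - m - 1 \<Longrightarrow> Q s = s + q"
    using P(1) by (rule exists_truncated_profile[where a = "- m"]) (rule that)
  define R where "R s = ln \<epsilon> + Q (s - ln \<epsilon>)" for s
  define F where "F = radial_map x0 R"
  have R: "radial_profile R (\<lambda>s. u (s - ln \<epsilon>))"
    unfolding R_def using Q(1) by (rule radial_profile_shift)
  have outer: "R s = s" if "ln \<epsilon> \<le> s" for s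
    using that m P(2)[of "s - ln \<epsilon>"] Q(3)[of "s - ln \<epsilon>"] by (simp add: R_def)
  have inner: "R s = s + q" if "s < ln (\<epsilon> * exp (- m - 1))" for s
    using that \<epsilon> Q(4)[of "s - ln \<epsilon>"] by (simp add: R_def ln_mult)
  have ident: "F y = y" if "\<epsilon> \<le> norm (y - x0)" for y
    unfolding F_def by (rule radial_map_ident_outside[OF outer \<epsilon> that])
  have "\<forall>\<^sub>F y in at_infinity. F y = y"
    using eventually_norm_diff_ge_at_infinity by (rule eventually_mono) (rule ident)
  moreover have "inj F"
    unfolding F_def by (intro inj_radial_map radial_profile_strict_mono[OF R])
  moreover have "regular_at F y" for y
    unfolding F_def using \<epsilon>
    by (intro regular_at_radial_map_everywhere[where \<delta> = "\<epsilon> * exp (- m - 1)", OF R _ inner]) simp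
  ultimately have tame: "tame_on UNIV F" by (simp add: tame_on_def)
  have ball: "norm (F y - x0) < 2 * \<epsilon>" if "norm (y - x0) < 2 * \<epsilon>" for y
    unfolding F_def using that \<epsilon>
    by (intro norm_radial_map_less radial_profile_strict_mono[OF R] outer) auto
  have "dilatation_bound \<Phi> (CARD('n) - 1) u C"
    using bound mono radial_profileD(3)[OF P(1)] Q(2) by (rule dilatation_bound_mono)
  then have "dilatation_bound \<Phi> (CARD('n) - 1) (\<lambda>s. u (s - ln \<epsilon>)) (C * exp \<bar>ln \<epsilon>\<bar>)"
    by (rule dilatation_bound_reparam) simp
  then have "\<Phi> (K_I F y) \<le> ennreal (C * exp \<bar>ln \<epsilon>\<bar> * pole_weight x0 y)" if "y \<noteq> x0" for y
    unfolding F_def using Phi_K_I_radial_map_le[OF R] that by blast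
  with tame ident ball have "concentrating_map \<Phi> x0 \<epsilon> (C * exp \<bar>ln \<epsilon>\<bar>) F"
    by (simp add: concentrating_map_def F_def)
  moreover have "\<epsilon> * exp (- L) \<le> norm (F y - x0)" if y: "norm (y - x0) = \<epsilon> * exp (- m)" for y
  proof -
    have "y \<noteq> x0" using y \<epsilon> by auto
    then have "norm (F y - x0) = exp (ln \<epsilon> + P (- m))"
      using \<epsilon> Q(3)[of "- m"] by (simp add: F_def norm_radial_map y R_def ln_mult)
    then show ?thesis using \<epsilon> P(3)[of "- m"] by (simp add: exp_add)
  qed
  ultimately show thesis by (rule that)
qed

lemma cavity_concentrating_comp_locally_eq:
  assumes G: "cavity_map \<Phi> p x0 \<epsilon> G" and F: "concentrating_map \<Phi> x0 \<epsilon> B F"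
  obtains U where "open U" "x \<in> U" "\<And>y. y \<in> U \<Longrightarrow> F y = (G \<circ> F) y"
  | U where "open U" "x \<in> U" "\<And>y. y \<in> U \<Longrightarrow> G y = (G \<circ> F) y"
proof (cases "norm (x - x0) < 2 * \<epsilon>")
  case True
  show thesis
  proof (rule that(1))
    show "open {y. norm (y - x0) < 2 * \<epsilon>}"
      by (intro open_Collect_less continuous_intros)
  qed (use True G F in \<open>auto simp: cavity_map_def concentrating_map_def\<close>)
next
  case False
  show thesis
  proof (rule that(2))
    show "open {y. \<epsilon> < norm (y - x0)}"
      by (intro open_Collect_less continuous_intros)
  qed (use False G F in \<open>auto simp: cavity_map_def concentrating_map_def\<close>)
qed

lemma K_I_cavity_concentrating_comp:
  assumes "cavity_map \<Phi> p x0 \<epsilon> G" "concentrating_map \<Phi> x0 \<epsilon> B F"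
  shows "K_I (G \<circ> F) x = K_I F x \<or> K_I (G \<circ> F) x = K_I G x"
  using assms
proof (rule cavity_concentrating_comp_locally_eq[where x = x])
  fix U assume "open U" "x \<in> U" "\<And>y. y \<in> U \<Longrightarrow> F y = (G \<circ> F) y"
  then show ?thesis using K_I_cong_open[of U x F "G \<circ> F"] by simp
next
  fix U assume "open U" "x \<in> U" "\<And>y. y \<in> U \<Longrightarrow> G y = (G \<circ> F) y"
  then show ?thesis using K_I_cong_open[of U x G "G \<circ> F"] by simp
qed

lemma concentrating_map_neq:
  assumes G: "cavity_map \<Phi> p x0 \<epsilon> G" and F: "concentrating_map \<Phi> x0 \<epsilon> B F" and "d \<noteq> p"
  shows "map_option F d \<noteq> p"
proof
  assume eq: "map_option F d = p"
  have inj: "inj F" using F by (simp add: concentrating_map_def tame_on_def)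
  show False
  proof (cases p)
    case (Some y)
    then have "F y = y" using G F by (simp add: cavity_map_def concentrating_map_def)
    then show False using eq Some assms(3) injD[OF inj] by (cases d) auto
  qed (use eq assms(3) in auto)
qed

lemma tame_on_cavity_concentrating_comp:
  assumes G: "cavity_map \<Phi> p x0 \<epsilon> G" and F: "concentrating_map \<Phi> x0 \<epsilon> B F"
  shows "tame_on (- {p}) (G \<circ> F)"
  unfolding tame_on_def
proof (intro conjI allI impI)
  have tame_G: "tame_on (- {p}) G" using G by (simp add: cavity_map_def)
  have tame_F: "tame_on UNIV F" using F by (simp add: concentrating_map_def)
  show "inj_on (G \<circ> F) {x. Some x \<in> - {p}}"
  proof (rule comp_inj_on)
    show "inj_on F {x. Some x \<in> - {p}}"
      using tame_F by (auto simp: tame_on_def intro: inj_on_subset)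
    have "F ` {x. Some x \<in> - {p}} \<subseteq> {x. Some x \<in> - {p}}"
      using concentrating_map_neq[OF G F, of "Some x" for x] by auto
    then show "inj_on G (F ` {x. Some x \<in> - {p}})"
      using tame_G by (auto simp: tame_on_def intro: inj_on_subset)
  qed
  show "regular_at (G \<circ> F) x" if "Some x \<in> - {p}" for x
    using G F
  proof (rule cavity_concentrating_comp_locally_eq[where x = x])
    fix U assume "open U" "x \<in> U" "\<And>y. y \<in> U \<Longrightarrow> F y = (G \<circ> F) y"
    then show ?thesis by (rule regular_at_cong_open) (use tame_F in \<open>auto simp: tame_on_def\<close>)
  next
    fix U assume "open U" "x \<in> U" "\<And>y. y \<in> U \<Longrightarrow> G y = (G \<circ> F) y"
    then show ?thesis by (rule regular_at_cong_open) (use tame_G that in \<open>auto simp: tame_on_def\<close>)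
  qed
  show "\<forall>\<^sub>F x in at_infinity. (G \<circ> F) x = x" if "None \<in> - {p}"
  proof -
    have "\<forall>\<^sub>F x in at_infinity. F x = x" "\<forall>\<^sub>F x in at_infinity. G x = x"
      using tame_F tame_G that by (auto simp: tame_on_def)
    then show ?thesis by eventually_elim simp
  qed
qed

lemma spherical_energy_le:
  fixes a b :: "real^'n"
  assumes "0 \<le> A" "0 \<le> B"
    and K: "\<And>x. x \<in> \<Omega> \<Longrightarrow> x \<noteq> a \<Longrightarrow> x \<noteq> b \<Longrightarrow> K x \<le> ennreal (A * pole_weight a x) + ennreal (B * pole_weight b x)"
  shows "(\<integral>\<^sup>+x\<in>\<Omega>. K x * ennreal (1 / (1 + (norm x)\<^sup>2) ^ CARD('n)) \<partial>lborel)
    \<le> ennreal A * pole_moment a + ennreal B * pole_moment b"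
proof -
  let ?W = "\<lambda>x::real^'n. 1 / (1 + (norm x)\<^sup>2) ^ CARD('n)"
  have W: "0 \<le> ?W x" for x by (auto intro!: divide_nonneg_nonneg zero_le_power add_nonneg_nonneg)
  have "K x * ennreal (?W x) * indicator \<Omega> x
      \<le> ennreal A * ennreal (pole_weight a x * ?W x) + ennreal B * ennreal (pole_weight b x * ?W x)"
    if "x \<noteq> a" "x \<noteq> b" for x
  proof (cases "x \<in> \<Omega>")
    case True
    then have "K x * ennreal (?W x)
        \<le> (ennreal (A * pole_weight a x) + ennreal (B * pole_weight b x)) * ennreal (?W x)"
      using K that by (intro mult_right_mono) auto
    also have "\<dots> = ennreal A * ennreal (pole_weight a x * ?W x)
        + ennreal B * ennreal (pole_weight b x * ?W x)"
      using assms(1,2) W[of x] pole_weight_nonneg[of a x] pole_weight_nonneg[of b x]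
      by (simp only: ennreal_mult distrib_right mult.assoc)
    finally show ?thesis using True by simp
  qed simp
  then have "(\<integral>\<^sup>+x\<in>\<Omega>. K x * ennreal (?W x) \<partial>lborel)
      \<le> (\<integral>\<^sup>+x. ennreal A * ennreal (pole_weight a x * ?W x)
          + ennreal B * ennreal (pole_weight b x * ?W x) \<partial>lborel)"
    using AE_lborel_singleton[of a] AE_lborel_singleton[of b] by (intro nn_integral_mono_AE) auto
  also have "\<dots> = ennreal A * pole_moment a + ennreal B * pole_moment b"
    unfolding pole_moment_def by (subst nn_integral_add) (auto simp: nn_integral_cmult)
  finally show ?thesis .
qed

lemma tame_on_subset: "tame_on A g \<Longrightarrow> B \<subseteq> A \<Longrightarrow> tame_on B g"
  unfolding tame_on_def by (auto intro: inj_on_subset)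

lemma exists_cavity_map:
  fixes x0 :: "real^'n"
  assumes "cavitating_profile \<Phi> (CARD('n) - 1) P v L C" "p \<noteq> Some x0"
  obtains \<epsilon> G where "cavity_map \<Phi> p x0 \<epsilon> G"
  using assms cavity_map_infinite cavity_map_finite by (cases p) blast+

lemma image_cavity_concentrating_comp:
  assumes "cavity_map \<Phi> p x0 \<epsilon> G" "concentrating_map \<Phi> x0 \<epsilon> B F"
  shows "map_option (G \<circ> F) ` (- {p}) \<subseteq> map_option G ` (- {p})"
proof
  fix z assume "z \<in> map_option (G \<circ> F) ` (- {p})"
  then obtain d where d: "d \<noteq> p" "z = map_option G (map_option F d)"
    by (auto simp: option.map_comp)
  with concentrating_map_neq[OF assms d(1)] show "z \<in> map_option G ` (- {p})" by blast
qed

lemma energy_cavity_concentrating_comp_le: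
  fixes \<Omega> :: "(real^'n) set"
  assumes G: "cavity_map \<Phi> p x0 \<epsilon> G" and F: "concentrating_map \<Phi> x0 \<epsilon> B F" and "0 \<le> A" "0 \<le> B"
    and K_I_G: "\<And>x. Some x \<noteq> p \<Longrightarrow> x \<noteq> c \<Longrightarrow> \<Phi> (K_I G x) \<le> ennreal (A * pole_weight c x)"
    and \<Omega>: "\<And>x. x \<in> \<Omega> \<Longrightarrow> Some x \<noteq> p"
  shows "(\<integral>\<^sup>+x\<in>\<Omega>. \<Phi> (K_I (G \<circ> F) x) * ennreal (1 / (1 + (norm x)\<^sup>2) ^ CARD('n)) \<partial>lborel)
    \<le> ennreal B * pole_moment x0 + ennreal A * pole_moment c"
proof (rule spherical_energy_le[OF assms(4,3)])
  fix x assume x: "x \<in> \<Omega>" "x \<noteq> x0" "x \<noteq> c"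
  then have "\<Phi> (K_I F x) \<le> ennreal (B * pole_weight x0 x)" "\<Phi> (K_I G x) \<le> ennreal (A * pole_weight c x)"
    using F K_I_G \<Omega> by (simp_all add: concentrating_map_def)
  then show "\<Phi> (K_I (G \<circ> F) x) \<le> ennreal (B * pole_weight x0 x) + ennreal (A * pole_weight c x)"
    using K_I_cavity_concentrating_comp[OF G F, of x] by (auto intro: add_increasing add_increasing2)
qed

lemma exists_S_class_containing_comp:
  fixes D :: "(real^'n) option set"
  assumes n: "2 \<le> CARD('n)" and D: "openin xtop D" "p \<notin> D"
    and G: "cavity_map \<Phi> p x0 \<epsilon> G" and "0 \<le> B"
  obtains M \<Delta> where "0 < M" "0 < \<Delta>" "\<Delta> < 1"
    "\<And>F. concentrating_map \<Phi> x0 \<epsilon> B F \<Longrightarrow> map_option (G \<circ> F) \<in> S_class D \<Phi> M \<Delta>"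
proof -
  obtain q1 q2 where q: "q1 \<noteq> q2" "{q1, q2} \<inter> map_option G ` (- {p}) = {}"
    using G unfolding cavity_map_def by blast
  obtain A c where A: "0 \<le> A"
    and K_I_G: "\<And>x. Some x \<noteq> p \<Longrightarrow> x \<noteq> c \<Longrightarrow> \<Phi> (K_I G x) \<le> ennreal (A * pole_weight c x)"
    using G unfolding cavity_map_def by blast
  define I where "I = ennreal B * pole_moment x0 + ennreal A * pole_moment c"
  define M where "M = enn2real I + 1"
  have "I < \<infinity>"
    using pole_moment_finite[of x0] pole_moment_finite[of c] n by (simp add: I_def ennreal_mult_less_top)
  then have "I = ennreal (enn2real I)" by simp
  also have "\<dots> \<le> ennreal M" by (rule ennreal_leI) (simp add: M_def)
  finally have I: "I \<le> ennreal M" .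
  define \<Delta> where "\<Delta> = min (1 / 2) (chordal q1 q2)"
  have \<Delta>: "0 < \<Delta>" "\<Delta> < 1" "\<Delta> \<le> chordal q1 q2"
    using q(1) chordal.mdist_pos_eq[of q1 q2] by (auto simp: \<Delta>_def)
  have "map_option (G \<circ> F) \<in> S_class D \<Phi> M \<Delta>" if F: "concentrating_map \<Phi> x0 \<epsilon> B F" for F
  proof (rule map_option_in_S_class[OF D(1)])
    have D': "D \<subseteq> - {p}" using D(2) by blast
    then show "tame_on D (G \<circ> F)"
      by (rule tame_on_subset[OF tame_on_cavity_concentrating_comp[OF G F]])
    show "q1 \<notin> map_option (G \<circ> F) ` D" "q2 \<notin> map_option (G \<circ> F) ` D"
      using q(2) image_cavity_concentrating_comp[OF G F] D' by blast+
    have "(\<integral>\<^sup>+x\<in>{x. Some x \<in> D}. \<Phi> (K_I (G \<circ> F) x) * ennreal (1 / (1 + (norm x)\<^sup>2) ^ CARD('n)) \<partial>lborel) \<le> I"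
      unfolding I_def using D(2) by (intro energy_cavity_concentrating_comp_le[OF G F A assms(5) K_I_G]) auto
    then show "(\<integral>\<^sup>+x\<in>{x. Some x \<in> D}. \<Phi> (K_I (G \<circ> F) x) * ennreal (1 / (1 + (norm x)\<^sup>2) ^ CARD('n)) \<partial>lebesgue)
        \<le> ennreal M"
      unfolding nn_integral_completion using I by (rule order_trans)
  qed (rule \<Delta>(3))
  moreover have "0 < M" by (simp add: M_def add_nonneg_pos)
  ultimately show thesis using \<Delta>(1,2) that by blast
qed

lemma exists_concentrating_sequence:
  fixes x0 :: "real^'n"
  assumes "mono \<Phi>" "cavitating_profile \<Phi> (CARD('n) - 1) P v L C" and \<epsilon>: "0 < \<epsilon>"
  obtains x F where "x \<longlonglongrightarrow> x0" "\<And>m. concentrating_map \<Phi> x0 \<epsilon> (C * exp \<bar>ln \<epsilon>\<bar>) (F m)"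
    "\<And>m::nat. norm (x m - x0) \<le> \<epsilon>" "\<And>m. \<epsilon> * exp (- L) \<le> norm (F m (x m) - x0)"
proof -
  obtain e :: "real^'n" where e: "norm e = 1" using vector_choose_size zero_le_one by blast
  define x where "x m = x0 + (\<epsilon> * exp (- real m)) *\<^sub>R e" for m
  have norm_x: "norm (x m - x0) = \<epsilon> * exp (- real m)" for m using \<epsilon> e by (simp add: x_def)
  have "\<exists>F. concentrating_map \<Phi> x0 \<epsilon> (C * exp \<bar>ln \<epsilon>\<bar>) F \<and> \<epsilon> * exp (- L) \<le> norm (F (x m) - x0)" for m
    by (rule exists_concentrating_map[OF assms, of "real m" x0]) (use norm_x in auto)
  then obtain F where F: "\<And>m. concentrating_map \<Phi> x0 \<epsilon> (C * exp \<bar>ln \<epsilon>\<bar>) (F m)"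
    "\<And>m. \<epsilon> * exp (- L) \<le> norm (F m (x m) - x0)" by metis
  have "(\<lambda>m. \<epsilon> * exp (- 1) ^ m) \<longlonglongrightarrow> \<epsilon> * 0"
    by (intro tendsto_intros LIMSEQ_power_zero) auto
  then have "(\<lambda>m. norm (x m - x0)) \<longlonglongrightarrow> 0"
    by (simp add: norm_x flip: exp_of_nat_mult)
  then have "x \<longlonglongrightarrow> x0" by (simp add: tendsto_norm_zero_iff LIM_zero_iff)
  moreover have "norm (x m - x0) \<le> \<epsilon>" for m unfolding norm_x using \<epsilon> by simp
  ultimately show thesis using F by (intro that)
qed

lemma openin_xtop_imp_ex_Some:
  fixes D :: "(real^'n) option set"
  assumes "openin xtop D" "D \<noteq> {}"
  obtains x where "Some x \<in> D"
proof (cases "None \<in> D")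
  case True
  then have "\<forall>\<^sub>F x in at_infinity. Some x \<in> D" using assms(1) by (simp add: openin_xtop_iff)
  then show thesis using eventually_happens'[OF trivial_limit_at_infinity] that by blast
next
  case False
  then show thesis using assms(2) that by (metis all_not_in_conv option.exhaust)
qed

lemma not_equicontinuous_S_class:
  fixes D :: "(real^'n) option set"
  assumes n: "2 \<le> CARD('n)" and mono: "mono \<Phi>"
    and profile: "cavitating_profile \<Phi> (CARD('n) - 1) P v L C"
    and D: "openin xtop D" "Some x0 \<in> D" "p \<notin> D"
  obtains M \<Delta> where "0 < M" "0 < \<Delta>" "\<Delta> < 1" "\<not> equicontinuous_fam D (S_class D \<Phi> M \<Delta>)"
proof -
  have "p \<noteq> Some x0" using D by auto
  then obtain \<epsilon> G where G: "cavity_map \<Phi> p x0 \<epsilon> G"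
    by (rule exists_cavity_map[OF profile])
  then have \<epsilon>: "0 < \<epsilon>" and G_ident: "\<And>y. norm (y - x0) < 2 * \<epsilon> \<Longrightarrow> G y = y"
    by (simp_all add: cavity_map_def)
  have "0 \<le> C * exp \<bar>ln \<epsilon>\<bar>"
    using cavitating_profileD(4)[OF profile] by (simp add: dilatation_bound_def)
  then obtain M \<Delta> where M: "0 < M" "0 < \<Delta>" "\<Delta> < 1"
    and mem: "\<And>F. concentrating_map \<Phi> x0 \<epsilon> (C * exp \<bar>ln \<epsilon>\<bar>) F \<Longrightarrow> map_option (G \<circ> F) \<in> S_class D \<Phi> M \<Delta>"
    by (rule exists_S_class_containing_comp[OF n D(1,3) G]) (rule that)
  obtain x F where x: "x \<longlonglongrightarrow> x0" "\<And>m::nat. norm (x m - x0) \<le> \<epsilon>"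
    and F: "\<And>m. concentrating_map \<Phi> x0 \<epsilon> (C * exp \<bar>ln \<epsilon>\<bar>) (F m)"
    and far: "\<And>m. \<epsilon> * exp (- L) \<le> norm (F m (x m) - x0)"
    by (rule exists_concentrating_sequence[OF mono profile \<epsilon>]) (rule that)
  obtain \<eta> where \<eta>: "0 < \<eta>"
    "\<And>q. \<forall>y. q = Some y \<longrightarrow> \<epsilon> * exp (- L) \<le> norm (x0 - y) \<Longrightarrow> \<eta> \<le> chordal (Some x0) q"
    using chordal_lower_bound_away[of "\<epsilon> * exp (- L)" x0] \<epsilon> by auto
  have apart: "\<eta> \<le> chordal (map_option (G \<circ> F m) (Some (x m))) (map_option (G \<circ> F m) (Some x0))" for m
  proof -
    have "(G \<circ> F m) (x m) = F m (x m)" "(G \<circ> F m) x0 = x0"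
      using F[of m] x(2)[of m] \<epsilon> by (simp_all add: concentrating_map_def G_ident)
    moreover have "\<eta> \<le> chordal (Some x0) (Some (F m (x m)))"
      using far[of m] by (intro \<eta>(2)) (simp add: norm_minus_commute)
    ultimately show ?thesis by (simp only: option.map chordal.commute[of _ "Some x0"])
  qed
  have "limitin xtop (\<lambda>m. Some (x m)) (Some x0) sequentially"
    using x(1) by (rule limitin_xtop_Some)
  moreover from this have "\<forall>\<^sub>F m in sequentially. Some (x m) \<in> D"
    using D(1,2) by (simp add: limitin_def)
  ultimately have lim: "limitin (subtopology xtop D) (\<lambda>m. Some (x m)) (Some x0) sequentially"
    using D(2) by (simp add: limitin_subtopology)
  have "\<not> equicontinuous_fam D (S_class D \<Phi> M \<Delta>)"
  proof
    assume "equicontinuous_fam D (S_class D \<Phi> M \<Delta>)"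
    then have "(\<lambda>m. chordal (map_option (G \<circ> F m) (Some (x m))) (map_option (G \<circ> F m) (Some x0))) \<longlonglongrightarrow> 0"
      by (rule equicontinuous_fam_sequentially[OF _ mem[OF F] lim])
    then have "\<eta> \<le> 0"
      by (rule tendsto_lowerbound) (intro always_eventually allI apart, simp)
    then show False using \<eta>(1) by simp
  qed
  with M show thesis by (rule that)
qed

theorem theorem5p1:
  fixes D :: "(real^'n) option set"
    and \<Phi> :: "ennreal \<Rightarrow> ennreal"
  assumes "CARD('n) \<ge> 2"
    and "xdomain D"
    and "D \<noteq> UNIV"
    and "mono \<Phi>"
    and "ext_convex \<Phi>"
    and "(\<forall>M \<Delta>. 0 < M \<and> 0 < \<Delta> \<and> \<Delta> < 1 \<longrightarrow> equicontinuous_fam D (S_class D \<Phi> M \<Delta>))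
       \<or> (\<forall>M \<Delta>. 0 < M \<and> 0 < \<Delta> \<and> \<Delta> < 1 \<longrightarrow> normal_fam D (S_class D \<Phi> M \<Delta>))"
  shows "\<forall>\<delta>::real. \<Phi> 0 < ennreal \<delta> \<longrightarrow>
     (\<integral>\<^sup>+\<tau>\<in>{\<delta><..}. 1 / (ennreal \<tau> * ennpowr (gen_inv \<Phi> (ennreal \<tau>)) (1 / (real CARD('n) - 1))) \<partial>lebesgue) = \<infinity>"
proof (intro allI impI, rule ccontr)
  fix \<delta> :: real
  assume "(\<integral>\<^sup>+\<tau>\<in>{\<delta><..}. 1 / (ennreal \<tau> * ennpowr (gen_inv \<Phi> (ennreal \<tau>)) (1 / (real CARD('n) - 1)))
      \<partial>lebesgue) \<noteq> \<infinity>"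
  then obtain P v L C where profile: "cavitating_profile \<Phi> (CARD('n) - 1) P v L C"
    unfolding nn_integral_completion gen_inv_integrand_def[symmetric]
    by (rule exists_cavitating_profile[OF assms(1,4)])
  have D: "openin xtop D" "D \<noteq> {}" using assms(2) by (auto simp: xdomain_def)
  obtain x0 where "Some x0 \<in> D" using D by (rule openin_xtop_imp_ex_Some)
  moreover obtain p where "p \<notin> D" using assms(3) by blast
  ultimately obtain M \<Delta> where "0 < M" "0 < \<Delta>" "\<Delta> < 1" "\<not> equicontinuous_fam D (S_class D \<Phi> M \<Delta>)"
    by (rule not_equicontinuous_S_class[OF assms(1,4) profile D(1)])
  then show False using assms(6) normal_fam_imp_equicontinuous_fam by blast
qed

end
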